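(* Let $H$ be a subset of $\operatorname{Sym}_n$, let $K$ be a field and let $S=S_n(H)$. If $Q$ is a prime ideal of $S$ such that $SzS\subseteq Q$, then $K[S]/K[Q]$ is a prime monomial algebra. Furthermore, if $Q$ is finitely generated (as an ideal of $S$), then $K[S]/K[Q]$ is either a PI algebra or a primitive algebra.
   Context: $S_n(H)$ is the monoid with presentation $\langle a_1,\dots,a_n \mid a_1\cdots a_n = a_{\sigma(1)}\cdots a_{\sigma(n)},\ \sigma\in H\rangle$, $z=a_1a_2\cdots a_n$, and $K[S]$ is the monoid algebra; for an ideal $Q$ of $S$, $K[Q]$ denotes the $K$-linear span of $Q$ in $K[S]$ (an ideal of $K[S]$). An ideal $Q$ of $S$ is prime if $Q\neq S$ and $uSv\subseteq Q$ implies $u\in Q$ or $v\in Q$. A monomial algebra is an algebra of the form $K\langle x_1,\dots,x_n\rangle/I$ where $I$ is an ideal of the free algebra generated by monomials (words). *)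

theory Defs
  imports "HOL-Algebra.QuotRing" "HOL-Algebra.FiniteProduct" "HOL-Combinatorics.Permutations"
begin

text \<open>Generators a_1,...,a_n are encoded as the letters 1,...,n; words are nat lists.
  z = a_1 a_2 ... a_n is the word [1..n].\<close>

definition zword :: "nat \<Rightarrow> nat list" where
  "zword n = [1..<Suc n]"

definition Sstep :: "nat \<Rightarrow> (nat \<Rightarrow> nat) set \<Rightarrow> nat list \<Rightarrow> nat list \<Rightarrow> bool" where
  "Sstep n H w w' \<longleftrightarrow> (\<exists>u v \<sigma>. \<sigma> \<in> H \<and> w = u @ zword n @ v \<and> w' = u @ map \<sigma> (zword n) @ v)"

definition Scong :: "nat \<Rightarrow> (nat \<Rightarrow> nat) set \<Rightarrow> nat list \<Rightarrow> nat list \<Rightarrow> bool" where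
  "Scong n H = (symclp (Sstep n H))\<^sup>*\<^sup>*"

definition Scls :: "nat \<Rightarrow> (nat \<Rightarrow> nat) set \<Rightarrow> nat list \<Rightarrow> nat list set" where
  "Scls n H w = {v. Scong n H w v}"

definition Smon :: "nat \<Rightarrow> (nat \<Rightarrow> nat) set \<Rightarrow> nat list set set" where
  "Smon n H = Scls n H ` lists {1..n}"

definition Smult :: "nat \<Rightarrow> (nat \<Rightarrow> nat) set \<Rightarrow> nat list set \<Rightarrow> nat list set \<Rightarrow> nat list set" where
  "Smult n H X Y = {w. \<exists>x\<in>X. \<exists>y\<in>Y. Scong n H (x @ y) w}"

definition Sone :: "nat \<Rightarrow> (nat \<Rightarrow> nat) set \<Rightarrow> nat list set" where
  "Sone n H = Scls n H []"

definition Sz :: "nat \<Rightarrow> (nat \<Rightarrow> nat) set \<Rightarrow> nat list set" where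
  "Sz n H = Scls n H (zword n)"

definition mon_ideal :: "'s set \<Rightarrow> ('s \<Rightarrow> 's \<Rightarrow> 's) \<Rightarrow> 's set \<Rightarrow> bool" where
  "mon_ideal S m Q \<longleftrightarrow> Q \<subseteq> S \<and> (\<forall>s\<in>S. \<forall>q\<in>Q. m s q \<in> Q \<and> m q s \<in> Q)"

definition mon_prime_ideal :: "'s set \<Rightarrow> ('s \<Rightarrow> 's \<Rightarrow> 's) \<Rightarrow> 's set \<Rightarrow> bool" where
  "mon_prime_ideal S m Q \<longleftrightarrow> mon_ideal S m Q \<and> Q \<noteq> S \<and>
     (\<forall>u\<in>S. \<forall>v\<in>S. {m (m u s) v | s. s \<in> S} \<subseteq> Q \<longrightarrow> u \<in> Q \<or> v \<in> Q)"

definition mon_ideal_fin_gen :: "'s set \<Rightarrow> ('s \<Rightarrow> 's \<Rightarrow> 's) \<Rightarrow> 's set \<Rightarrow> bool" where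
  "mon_ideal_fin_gen S m Q \<longleftrightarrow>
     (\<exists>F. finite F \<and> F \<subseteq> Q \<and> Q = {m (m s f) t | s f t. s \<in> S \<and> f \<in> F \<and> t \<in> S})"

definition malg :: "'s set \<Rightarrow> ('s \<Rightarrow> 's \<Rightarrow> 's) \<Rightarrow> 's \<Rightarrow> ('s \<Rightarrow> 'k::field) ring" where
  "malg S mop e = \<lparr> carrier = {f. finite {x. f x \<noteq> 0} \<and> (\<forall>x. f x \<noteq> 0 \<longrightarrow> x \<in> S)},
      monoid.mult = (\<lambda>f g s. \<Sum>p\<in>{(x, y). x \<in> S \<and> y \<in> S \<and> f x \<noteq> 0 \<and> g y \<noteq> 0 \<and> mop x y = s}.
                         f (fst p) * g (snd p)),
      one = (\<lambda>x. if x = e then 1 else 0),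
      zero = (\<lambda>x. 0),
      add = (\<lambda>f g x. f x + g x) \<rparr>"

definition malg_smult :: "'k::field \<Rightarrow> ('s \<Rightarrow> 'k) \<Rightarrow> ('s \<Rightarrow> 'k)" where
  "malg_smult c f = (\<lambda>x. c * f x)"

definition malg_span :: "'s set \<Rightarrow> ('s \<Rightarrow> 's \<Rightarrow> 's) \<Rightarrow> 's \<Rightarrow> 's set \<Rightarrow> ('s \<Rightarrow> 'k::field) set" where
  "malg_span S m e Q = {f \<in> carrier (malg S m e :: ('s \<Rightarrow> 'k) ring). \<forall>x. f x \<noteq> 0 \<longrightarrow> x \<in> Q}"

definition quot_smult :: "('a, 'b) ring_scheme \<Rightarrow> 'a set \<Rightarrow> ('k \<Rightarrow> 'a \<Rightarrow> 'a) \<Rightarrow> 'k \<Rightarrow> 'a set \<Rightarrow> 'a set" where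
  "quot_smult R I sm c X = (\<Union>f\<in>X. I +>\<^bsub>R\<^esub> sm c f)"

definition free_alg :: "nat \<Rightarrow> (nat list \<Rightarrow> 'k::field) ring" where
  "free_alg m = malg (lists {1..m}) (@) []"

definition word_elem :: "nat list \<Rightarrow> (nat list \<Rightarrow> 'k::field)" where
  "word_elem w = (\<lambda>v. if v = w then 1 else 0)"

definition kalg_iso :: "('a, 'c) ring_scheme \<Rightarrow> ('k \<Rightarrow> 'a \<Rightarrow> 'a) \<Rightarrow>
     ('b, 'd) ring_scheme \<Rightarrow> ('k \<Rightarrow> 'b \<Rightarrow> 'b) \<Rightarrow> ('a \<Rightarrow> 'b) \<Rightarrow> bool" where
  "kalg_iso A smA B smB \<phi> \<longleftrightarrow> \<phi> \<in> ring_iso A B \<and>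
     (\<forall>c. \<forall>x\<in>carrier A. \<phi> (smA c x) = smB c (\<phi> x))"

definition monomial_algebra :: "('a, 'c) ring_scheme \<Rightarrow> ('k::field \<Rightarrow> 'a \<Rightarrow> 'a) \<Rightarrow> bool" where
  "monomial_algebra A sm \<longleftrightarrow>
     (\<exists>m W \<phi>. W \<subseteq> lists {1..m} \<and>
        (let F = (free_alg m :: (nat list \<Rightarrow> 'k) ring);
             I = genideal F (word_elem ` W)
         in kalg_iso A sm (F Quot I) (quot_smult F I malg_smult) \<phi>))"

definition prime_ring :: "('a, 'c) ring_scheme \<Rightarrow> bool" where
  "prime_ring A \<longleftrightarrow> \<one>\<^bsub>A\<^esub> \<noteq> \<zero>\<^bsub>A\<^esub> \<and>
     (\<forall>a\<in>carrier A. \<forall>b\<in>carrier A.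
        (\<forall>r\<in>carrier A. a \<otimes>\<^bsub>A\<^esub> r \<otimes>\<^bsub>A\<^esub> b = \<zero>\<^bsub>A\<^esub>) \<longrightarrow> a = \<zero>\<^bsub>A\<^esub> \<or> b = \<zero>\<^bsub>A\<^esub>)"

definition ncpoly_eval :: "('a, 'c) ring_scheme \<Rightarrow> ('k::field \<Rightarrow> 'a \<Rightarrow> 'a) \<Rightarrow>
     (nat list \<Rightarrow> 'k) \<Rightarrow> (nat \<Rightarrow> 'a) \<Rightarrow> 'a" where
  "ncpoly_eval A sm f a =
     finsum A (\<lambda>w. sm (f w) (foldr (\<lambda>x y. x \<otimes>\<^bsub>A\<^esub> y) (map a w) \<one>\<^bsub>A\<^esub>)) {w. f w \<noteq> 0}"

definition PI_algebra :: "('a, 'c) ring_scheme \<Rightarrow> ('k::field \<Rightarrow> 'a \<Rightarrow> 'a) \<Rightarrow> bool" where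
  "PI_algebra A sm \<longleftrightarrow>
     (\<exists>m. \<exists>f \<in> carrier (free_alg m :: (nat list \<Rightarrow> 'k) ring). f \<noteq> (\<lambda>_. 0) \<and>
        (\<forall>a. (\<forall>i\<in>{1..m}. a i \<in> carrier A) \<longrightarrow> ncpoly_eval A sm f a = \<zero>\<^bsub>A\<^esub>))"

definition left_ideal :: "'a set \<Rightarrow> ('a, 'c) ring_scheme \<Rightarrow> bool" where
  "left_ideal L A \<longleftrightarrow> additive_subgroup L A \<and>
     (\<forall>a\<in>carrier A. \<forall>x\<in>L. a \<otimes>\<^bsub>A\<^esub> x \<in> L)"

text \<open>(Left) primitive ring: there is a maximal left ideal L containing no nonzero
  two-sided ideal; equivalently A/L is a faithful simple left A-module.\<close>
definition primitive_ring :: "('a, 'c) ring_scheme \<Rightarrow> bool" where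
  "primitive_ring A \<longleftrightarrow>
     (\<exists>L. left_ideal L A \<and> L \<noteq> carrier A \<and>
        (\<forall>L'. left_ideal L' A \<and> L \<subseteq> L' \<longrightarrow> L' = L \<or> L' = carrier A) \<and>
        (\<forall>I. ideal I A \<and> I \<subseteq> L \<longrightarrow> I = {\<zero>\<^bsub>A\<^esub>}))"

end

theory Submission
  imports Defs "HOL-Library.Sublist" "HOL-Library.Countable"
begin

text \<open>
  Every defining relation of \<open>S\<close> involves \<open>z\<close>, so words whose class lies outside \<open>Q\<close> are alone in
  their class.  Hence \<open>K[S]/K[Q]\<close> has as basis the language \<open>L\<close> of these words, with products
  truncated to \<open>L\<close>: it is a monomial algebra.  As \<open>Q\<close> is prime, any two words of \<open>L\<close> can be connected
  inside \<open>L\<close>, and comparing longest words shows that the algebra is prime.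

  If \<open>Q\<close> is finitely generated, \<open>L\<close> is defined by finitely many forbidden factors.  If the words
  of \<open>L\<close> have bounded periods, they share a common period \<open>D\<close>, and a standard identity of degree
  depending on \<open>D\<close> holds.  Otherwise \<open>L\<close> contains words without small periods, and one builds a
  suffix code \<open>{g_w | w \<in> L}\<close> with free powers in \<open>L\<close>, where \<open>g_w = u_w w v_w\<close>, \<open>u_w\<close> has no period
  of length at most \<open>|w|\<close>, and \<open>v_w\<close> is a suffix of \<open>g_w\<close> only.  Imposing \<open>g_w e = e\<close> on a generator
  \<open>e\<close> whose only surviving words are suffixes of products of code words gives a cyclic module in
  which \<open>u_w f v_w e\<close> is a nonzero multiple of \<open>e\<close> whenever \<open>w\<close> is a longest word of \<open>f\<close>.  So the
  annihilator of \<open>e\<close> is comaximal with every nonzero ideal, and any maximal left ideal above it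
  shows primitivity.
\<close>

section \<open>Monoid algebras\<close>

lemma malg_simps:
  "carrier (malg S mop e) = {f. finite {x. f x \<noteq> 0} \<and> (\<forall>x. f x \<noteq> 0 \<longrightarrow> x \<in> S)}"
  "\<one>\<^bsub>malg S mop e\<^esub> = (\<lambda>x. if x = e then 1 else 0)"
  "\<zero>\<^bsub>malg S mop e\<^esub> = (\<lambda>x. 0)"
  "f \<oplus>\<^bsub>malg S mop e\<^esub> g = (\<lambda>x. f x + g x)"
  by (simp_all add: malg_def)

text \<open>Index sets larger than the supports let factors with different supports share one range
  of summation, which associativity and distributivity require.\<close>

lemma malg_mult:
  assumes "finite A" "finite B" "{x. f x \<noteq> 0} \<subseteq> A" "{x. g x \<noteq> 0} \<subseteq> B" "A \<subseteq> S" "B \<subseteq> S"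
  shows "(f \<otimes>\<^bsub>malg S mop e\<^esub> g) s = (\<Sum>x\<in>A. \<Sum>y\<in>B. if mop x y = s then f x * g y else 0)"
proof -
  let ?P = "{(x, y). x \<in> S \<and> y \<in> S \<and> f x \<noteq> 0 \<and> g y \<noteq> 0 \<and> mop x y = s}"
  have "(f \<otimes>\<^bsub>malg S mop e\<^esub> g) s = (\<Sum>p\<in>?P. f (fst p) * g (snd p))"
    by (simp add: malg_def)
  also have "\<dots> = (\<Sum>p\<in>A \<times> B. if mop (fst p) (snd p) = s then f (fst p) * g (snd p) else 0)"
    using assms by (intro sum.mono_neutral_cong_left) auto
  also have "\<dots> = (\<Sum>x\<in>A. \<Sum>y\<in>B. if mop x y = s then f x * g y else 0)"
    by (simp add: sum.cartesian_product case_prod_unfold)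
  finally show ?thesis .
qed

lemma malg_mult_closed:
  assumes closed: "\<And>x y. x \<in> S \<Longrightarrow> y \<in> S \<Longrightarrow> mop x y \<in> S"
    and f: "f \<in> carrier (malg S mop e)" and g: "g \<in> carrier (malg S mop e)"
  shows "f \<otimes>\<^bsub>malg S mop e\<^esub> g \<in> carrier (malg S mop e)"
    and "{x. (f \<otimes>\<^bsub>malg S mop e\<^esub> g) x \<noteq> 0} \<subseteq> (\<lambda>(x, y). mop x y) ` ({x. f x \<noteq> 0} \<times> {x. g x \<noteq> 0})"
proof -
  let ?A = "{x. f x \<noteq> 0}" and ?B = "{x. g x \<noteq> 0}"
  have fin: "finite ?A" "finite ?B" "?A \<subseteq> S" "?B \<subseteq> S"
    using f g by (auto simp: malg_simps)
  show *: "{x. (f \<otimes>\<^bsub>malg S mop e\<^esub> g) x \<noteq> 0} \<subseteq> (\<lambda>(x, y). mop x y) ` (?A \<times> ?B)"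
  proof
    fix s assume "s \<in> {x. (f \<otimes>\<^bsub>malg S mop e\<^esub> g) x \<noteq> 0}"
    then have "(\<Sum>x\<in>?A. \<Sum>y\<in>?B. if mop x y = s then f x * g y else 0) \<noteq> 0"
      using malg_mult[OF fin(1,2) subset_refl subset_refl fin(3,4), of mop e s] by simp
    then obtain x where x: "x \<in> ?A" "(\<Sum>y\<in>?B. if mop x y = s then f x * g y else 0) \<noteq> 0"
      by (rule sum.not_neutral_contains_not_neutral)
    from x(2) obtain y where "y \<in> ?B" "(if mop x y = s then f x * g y else 0) \<noteq> 0"
      by (rule sum.not_neutral_contains_not_neutral)
    with x show "s \<in> (\<lambda>(x, y). mop x y) ` (?A \<times> ?B)" by (auto split: if_splits)
  qed
  have "finite {x. (f \<otimes>\<^bsub>malg S mop e\<^esub> g) x \<noteq> 0}"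
    using * fin by (meson finite_SigmaI finite_imageI finite_subset)
  moreover have "{x. (f \<otimes>\<^bsub>malg S mop e\<^esub> g) x \<noteq> 0} \<subseteq> S"
    using * fin(3,4) by (auto simp: subset_iff image_iff intro: closed)
  ultimately show "f \<otimes>\<^bsub>malg S mop e\<^esub> g \<in> carrier (malg S mop e)"
    by (auto simp: malg_simps(1))
qed

lemma malg_ring:
  fixes S :: "'s set" and mop :: "'s \<Rightarrow> 's \<Rightarrow> 's" and e :: 's
  assumes closed: "\<And>x y. x \<in> S \<Longrightarrow> y \<in> S \<Longrightarrow> mop x y \<in> S"
    and assoc: "\<And>x y z. x \<in> S \<Longrightarrow> y \<in> S \<Longrightarrow> z \<in> S \<Longrightarrow> mop (mop x y) z = mop x (mop y z)"
    and e: "e \<in> S" and unitl: "\<And>x. x \<in> S \<Longrightarrow> mop e x = x" and unitr: "\<And>x. x \<in> S \<Longrightarrow> mop x e = x"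
  shows "ring (malg S mop e :: ('s \<Rightarrow> 'k::field) ring)" (is "ring ?R")
proof (rule ringI)
  have add_closed: "(\<lambda>x. f x + g x) \<in> carrier ?R"
    if "f \<in> carrier ?R" "g \<in> carrier ?R" for f g
  proof -
    have "{x. f x + g x \<noteq> 0} \<subseteq> {x. f x \<noteq> 0} \<union> {x. g x \<noteq> 0}" by auto
    with that show ?thesis by (auto simp: malg_simps finite_subset)
  qed
  have mc: "f \<otimes>\<^bsub>?R\<^esub> g \<in> carrier ?R"
    "{x. (f \<otimes>\<^bsub>?R\<^esub> g) x \<noteq> 0} \<subseteq> (\<lambda>(x, y). mop x y) ` ({x. f x \<noteq> 0} \<times> {x. g x \<noteq> 0})"
    if "f \<in> carrier ?R" "g \<in> carrier ?R" for f g
    using malg_mult_closed[of S mop f e g] closed that by blast+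
  show "abelian_group ?R"
  proof (rule abelian_groupI)
    fix f assume f: "f \<in> carrier ?R"
    show "\<exists>g\<in>carrier ?R. g \<oplus>\<^bsub>?R\<^esub> f = \<zero>\<^bsub>?R\<^esub>"
      using f by (intro bexI[of _ "\<lambda>x. - f x"]) (auto simp: malg_simps)
  next
    fix f g assume "f \<in> carrier ?R" "g \<in> carrier ?R"
    then show "f \<oplus>\<^bsub>?R\<^esub> g \<in> carrier ?R" using add_closed by (simp only: malg_simps(4))
  qed (simp_all add: malg_simps fun_eq_iff ac_simps)
  show "monoid ?R"
  proof (rule monoidI)
    show "\<one>\<^bsub>?R\<^esub> \<in> carrier ?R" using e by (auto simp: malg_simps)
  next
    fix f g assume "f \<in> carrier ?R" "g \<in> carrier ?R"
    then show "f \<otimes>\<^bsub>?R\<^esub> g \<in> carrier ?R" by (rule mc)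
  next
    fix f g h assume f: "f \<in> carrier ?R" and g: "g \<in> carrier ?R" and h: "h \<in> carrier ?R"
    let ?A = "{x. f x \<noteq> 0}" and ?B = "{x. g x \<noteq> 0}" and ?C = "{x. h x \<noteq> 0}"
    let ?AB = "(\<lambda>(x, y). mop x y) ` (?A \<times> ?B)" and ?BC = "(\<lambda>(x, y). mop x y) ` (?B \<times> ?C)"
    have fin: "finite ?A" "finite ?B" "finite ?C" "?A \<subseteq> S" "?B \<subseteq> S" "?C \<subseteq> S"
      using f g h by (auto simp: malg_simps)
    have fin2: "finite ?AB" "finite ?BC" "?AB \<subseteq> S" "?BC \<subseteq> S"
      using fin by (auto simp: subset_iff intro!: closed)
    note fg = malg_mult[OF fin(1,2) subset_refl subset_refl fin(4,5), of mop e]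
    note gh = malg_mult[OF fin(2,3) subset_refl subset_refl fin(5,6), of mop e]
    show "f \<otimes>\<^bsub>?R\<^esub> g \<otimes>\<^bsub>?R\<^esub> h = f \<otimes>\<^bsub>?R\<^esub> (g \<otimes>\<^bsub>?R\<^esub> h)"
    proof
      fix s
      \<comment> \<open>Both bracketings are brought to one sum over triples of support elements.
        The intermediate product \<open>t\<close> ranges over a finite set of products and
        disappears because exactly one \<open>t\<close> matches each pair.\<close>
      have "(f \<otimes>\<^bsub>?R\<^esub> g \<otimes>\<^bsub>?R\<^esub> h) s
          = (\<Sum>t\<in>?AB. \<Sum>z\<in>?C. if mop t z = s then (f \<otimes>\<^bsub>?R\<^esub> g) t * h z else 0)"
        by (rule malg_mult[OF fin2(1) fin(3) mc(2)[OF f g] subset_refl fin2(3) fin(6)])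
      also have "\<dots> = (\<Sum>t\<in>?AB. \<Sum>z\<in>?C. \<Sum>x\<in>?A. \<Sum>y\<in>?B.
          if mop x y = t then if mop t z = s then f x * g y * h z else 0 else 0)"
        by (intro sum.cong refl) (auto simp: fg sum_distrib_right cong: if_cong intro!: sum.cong)
      also have "\<dots> = (\<Sum>z\<in>?C. \<Sum>x\<in>?A. \<Sum>y\<in>?B. \<Sum>t\<in>?AB.
          if mop x y = t then if mop t z = s then f x * g y * h z else 0 else 0)"
        by (subst sum.swap, rule sum.cong[OF refl], subst sum.swap, rule sum.cong[OF refl],
            rule sum.swap)
      also have "\<dots> = (\<Sum>z\<in>?C. \<Sum>x\<in>?A. \<Sum>y\<in>?B.
          if mop (mop x y) z = s then f x * g y * h z else 0)"
        by (intro sum.cong refl, subst sum.delta'[OF fin2(1)]) auto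
      also have "\<dots> = (\<Sum>x\<in>?A. \<Sum>y\<in>?B. \<Sum>z\<in>?C.
          if mop (mop x y) z = s then f x * g y * h z else 0)"
        by (subst sum.swap, rule sum.cong[OF refl], rule sum.swap)
      also have "\<dots> = (\<Sum>x\<in>?A. \<Sum>y\<in>?B. \<Sum>z\<in>?C.
          if mop x (mop y z) = s then f x * g y * h z else 0)"
        using assoc fin by (intro sum.cong refl) (simp add: subset_iff)
      also have "\<dots> = (\<Sum>x\<in>?A. \<Sum>y\<in>?B. \<Sum>z\<in>?C. \<Sum>t\<in>?BC.
          if mop y z = t then if mop x t = s then f x * g y * h z else 0 else 0)"
        by (intro sum.cong refl, subst sum.delta'[OF fin2(2)]) auto
      also have "\<dots> = (\<Sum>x\<in>?A. \<Sum>t\<in>?BC. \<Sum>y\<in>?B. \<Sum>z\<in>?C.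
          if mop y z = t then if mop x t = s then f x * g y * h z else 0 else 0)"
        by (rule sum.cong[OF refl], rule trans[OF sum.cong[OF refl sum.swap] sum.swap])
      also have "\<dots> = (\<Sum>x\<in>?A. \<Sum>t\<in>?BC. if mop x t = s then f x * (g \<otimes>\<^bsub>?R\<^esub> h) t else 0)"
        by (intro sum.cong refl) (auto simp: gh sum_distrib_left mult.assoc cong: if_cong intro!: sum.cong)
      also have "\<dots> = (f \<otimes>\<^bsub>?R\<^esub> (g \<otimes>\<^bsub>?R\<^esub> h)) s"
        by (rule malg_mult[OF fin(1) fin2(2) subset_refl mc(2)[OF g h] fin(4) fin2(4), symmetric])
      finally show "(f \<otimes>\<^bsub>?R\<^esub> g \<otimes>\<^bsub>?R\<^esub> h) s = (f \<otimes>\<^bsub>?R\<^esub> (g \<otimes>\<^bsub>?R\<^esub> h)) s" .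
    qed
  next
    fix f assume f: "f \<in> carrier ?R"
    let ?A = "{x. f x \<noteq> 0}"
    have fin: "finite ?A" "?A \<subseteq> S" using f by (auto simp: malg_simps)
    have one: "finite {e}" "{x. \<one>\<^bsub>?R\<^esub> x \<noteq> 0} \<subseteq> {e}" "{e} \<subseteq> S"
      using e by (auto simp: malg_simps)
    show "\<one>\<^bsub>?R\<^esub> \<otimes>\<^bsub>?R\<^esub> f = f"
    proof
      fix s
      have "(\<one>\<^bsub>?R\<^esub> \<otimes>\<^bsub>?R\<^esub> f) s = (\<Sum>y\<in>?A. if mop e y = s then f y else 0)"
        by (subst malg_mult[OF one(1) fin(1) one(2) subset_refl one(3) fin(2)]) (simp add: malg_simps cong: if_cong)
      also have "\<dots> = (\<Sum>y\<in>?A. if y = s then f y else 0)"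
        using unitl fin by (intro sum.cong) auto
      also have "\<dots> = f s" using fin by (simp add: sum.delta)
      finally show "(\<one>\<^bsub>?R\<^esub> \<otimes>\<^bsub>?R\<^esub> f) s = f s" .
    qed
    show "f \<otimes>\<^bsub>?R\<^esub> \<one>\<^bsub>?R\<^esub> = f"
    proof
      fix s
      have "(f \<otimes>\<^bsub>?R\<^esub> \<one>\<^bsub>?R\<^esub>) s = (\<Sum>y\<in>?A. if mop y e = s then f y else 0)"
        by (subst malg_mult[OF fin(1) one(1) subset_refl one(2) fin(2) one(3)]) (simp add: malg_simps cong: if_cong)
      also have "\<dots> = (\<Sum>y\<in>?A. if y = s then f y else 0)"
        using unitr fin by (intro sum.cong) auto
      also have "\<dots> = f s" using fin by (simp add: sum.delta)
      finally show "(f \<otimes>\<^bsub>?R\<^esub> \<one>\<^bsub>?R\<^esub>) s = f s" .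
    qed
  qed
  fix f g h assume f: "f \<in> carrier ?R" and g: "g \<in> carrier ?R" and h: "h \<in> carrier ?R"
  let ?A = "{x. f x \<noteq> 0} \<union> {x. g x \<noteq> 0}" and ?C = "{x. h x \<noteq> 0}"
  have fin: "finite ?A" "?A \<subseteq> S" "finite ?C" "?C \<subseteq> S"
    using f g h by (auto simp: malg_simps)
  have sub: "{x. f x \<noteq> 0} \<subseteq> ?A" "{x. g x \<noteq> 0} \<subseteq> ?A" "{x. (f \<oplus>\<^bsub>?R\<^esub> g) x \<noteq> 0} \<subseteq> ?A"
    by (auto simp: malg_simps)
  show "(f \<oplus>\<^bsub>?R\<^esub> g) \<otimes>\<^bsub>?R\<^esub> h = f \<otimes>\<^bsub>?R\<^esub> h \<oplus>\<^bsub>?R\<^esub> g \<otimes>\<^bsub>?R\<^esub> h"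
  proof
    fix s show "((f \<oplus>\<^bsub>?R\<^esub> g) \<otimes>\<^bsub>?R\<^esub> h) s = (f \<otimes>\<^bsub>?R\<^esub> h \<oplus>\<^bsub>?R\<^esub> g \<otimes>\<^bsub>?R\<^esub> h) s"
      unfolding malg_simps(4)[of S mop e "f \<otimes>\<^bsub>?R\<^esub> h"]
        sub[THEN malg_mult[OF fin(1,3) _ subset_refl fin(2,4)]]
      by (simp add: malg_simps(4) sum.distrib[symmetric] distrib_right cong: if_cong)
         (auto intro!: sum.cong)
  qed
  show "h \<otimes>\<^bsub>?R\<^esub> (f \<oplus>\<^bsub>?R\<^esub> g) = h \<otimes>\<^bsub>?R\<^esub> f \<oplus>\<^bsub>?R\<^esub> h \<otimes>\<^bsub>?R\<^esub> g"
  proof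
    fix s show "(h \<otimes>\<^bsub>?R\<^esub> (f \<oplus>\<^bsub>?R\<^esub> g)) s = (h \<otimes>\<^bsub>?R\<^esub> f \<oplus>\<^bsub>?R\<^esub> h \<otimes>\<^bsub>?R\<^esub> g) s"
      unfolding malg_simps(4)[of S mop e "h \<otimes>\<^bsub>?R\<^esub> f"]
        sub[THEN malg_mult[OF fin(3,1) subset_refl _ fin(4,2)]]
      by (simp add: malg_simps(4) sum.distrib[symmetric] distrib_left cong: if_cong)
         (auto intro!: sum.cong)
  qed
qed

section \<open>Irreducible languages and suffix codes\<close>

text \<open>Zero and every \<open>q\<close> of at least \<open>length u\<close> count as periods.
  Hence a word without periods from 1 to a positive \<open>N\<close> is longer than
  \<open>N\<close>.\<close>

definition has_period :: "nat \<Rightarrow> 'a list \<Rightarrow> bool" where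
  "has_period q u \<longleftrightarrow> (\<forall>i. i + q < length u \<longrightarrow> u ! i = u ! (i + q))"

lemma has_period_factor:
  assumes "has_period q (a @ u @ b)" shows "has_period q u"
  unfolding has_period_def
proof (intro allI impI)
  fix i assume i: "i + q < length u"
  then have "(a @ u @ b) ! (length a + i) = (a @ u @ b) ! (length a + i + q)"
    by (intro assms[unfolded has_period_def, rule_format]) simp
  with i show "u ! i = u ! (i + q)"
    by (simp add: nth_append add.assoc)
qed

text \<open>The word \<open>u\<close> is a prefix of \<open>z @ u\<close>, so it agrees with its own
  shift by \<open>length z\<close>.\<close>

lemma has_period_if_shift:
  assumes "z @ u = u @ y" shows "has_period (length z) u"
  unfolding has_period_def
proof (intro allI impI)
  fix i assume i: "i + length z < length u"
  have "u ! i = (z @ u) ! (i + length z)" by (simp add: nth_append)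
  also have "\<dots> = u ! (i + length z)" using i by (simp only: assms) (simp add: nth_append)
  finally show "u ! i = u ! (i + length z)" .
qed

lemma has_period_mult:
  assumes "has_period q u" shows "has_period (k * q) u"
proof (induction k)
  case (Suc k)
  show ?case unfolding has_period_def
  proof (intro allI impI)
    fix i assume i: "i + Suc k * q < length u"
    then have "u ! i = u ! (i + k * q)" using Suc unfolding has_period_def by simp
    also have "\<dots> = u ! (i + k * q + q)" using assms i unfolding has_period_def by simp
    finally show "u ! i = u ! (i + Suc k * q)" by (simp add: algebra_simps)
  qed
qed (simp add: has_period_def)

lemma has_period_mod:
  assumes "has_period q u" "k < length u" shows "u ! k = u ! (k mod q)"
proof -
  have "has_period (k div q * q) u" using assms(1) by (rule has_period_mult)
  moreover have "k mod q + k div q * q = k" by simp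
  ultimately show ?thesis using assms(2) unfolding has_period_def by metis
qed

lemma uniform_period:
  assumes "\<And>u. u \<in> L \<Longrightarrow> \<exists>q. 0 < q \<and> q \<le> N \<and> has_period q u"
  shows "\<exists>D>0. \<forall>u\<in>L. has_period D u"
proof (intro exI conjI ballI)
  \<comment> \<open>Multiples of periods are periods, and \<open>fact N\<close> is a common multiple
    of all positive \<open>q \<le> N\<close>.\<close>
  show "(0::nat) < fact N" by simp
  fix u assume "u \<in> L"
  then obtain q where q: "0 < q" "q \<le> N" "has_period q u" using assms by blast
  then have "q dvd fact N" by (intro dvd_fact) auto
  then obtain k where "fact N = k * q" by (metis dvd_def mult.commute)
  with has_period_mult[OF q(3)] show "has_period (fact N) u" by simp
qed

section \<open>Irreducible languages of finite type and return words\<close>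

text \<open>Closure under prefixes and suffixes gives closure under all factors, so the words of
  \<open>L\<close> can serve as basis of a monomial algebra. Irreducibility is the combinatorial
  form of primeness.\<close>

locale irreducible_language =
  fixes L :: "'a list set"
  assumes Nil_mem: "[] \<in> L"
    and prefix_mem: "u @ v \<in> L \<Longrightarrow> u \<in> L"
    and suffix_mem: "u @ v \<in> L \<Longrightarrow> v \<in> L"
    and irreducible: "u \<in> L \<Longrightarrow> v \<in> L \<Longrightarrow> \<exists>s. u @ s @ v \<in> L"

text \<open>As for shifts of finite type, an overlap of length \<open>d\<close> suffices for gluing.
  Countability of the alphabet lets \<open>markers_exist\<close> number the words by
  \<open>to_nat\<close>.\<close>

locale finite_type_language = irreducible_language L for L :: "'a::countable list set" +
  fixes d :: nat
  assumes glue: "d \<le> length s \<Longrightarrow> u @ s \<in> L \<Longrightarrow> s @ v \<in> L \<Longrightarrow> u @ s @ v \<in> L"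
begin

text \<open>These are loops at \<open>p\<close>: as \<open>t @ p\<close> begins and ends with
  \<open>p\<close>, they compose by gluing along \<open>p\<close> once \<open>p\<close> has length
  at least \<open>d\<close>.\<close>

definition returns :: "'a list \<Rightarrow> 'a list set" where
  "returns p = {t. t @ p \<in> L \<and> prefix p (t @ p)}"

lemma returns_append:
  assumes "d \<le> length p" "s \<in> returns p" "t \<in> returns p" shows "s @ t \<in> returns p"
proof -
  obtain r where r: "t @ p = p @ r" using assms(3) by (auto simp: returns_def prefix_def)
  have "s @ p @ r \<in> L"
    using assms r by (intro glue) (auto simp: returns_def)
  moreover have "prefix p (s @ p @ r)"
    using assms(2) by (metis (no_types, lifting) append.assoc mem_Collect_eq prefix_prefix returns_def)
  ultimately show ?thesis using r by (simp add: returns_def)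
qed

text \<open>Writing \<open>t @ p = p @ r\<close> moves \<open>t\<close> behind \<open>p\<close>, so
  \<open>s @ p\<close> is a prefix of a word of \<open>L\<close> and still begins with
  \<open>p\<close>. Cancellation on the right is what the choice of \<open>y\<close> as a shortest
  return in \<open>markers_exist\<close> rests on.\<close>

lemma returns_cancel:
  assumes "s @ t \<in> returns p" "t \<in> returns p" shows "s \<in> returns p"
proof -
  obtain r where r: "t @ p = p @ r" using assms(2) by (auto simp: returns_def prefix_def)
  have L: "(s @ p) @ r \<in> L" and p: "prefix p ((s @ p) @ r)"
    using assms(1) r by (auto simp: returns_def)
  from L have "s @ p \<in> L" by (rule prefix_mem)
  moreover from p have "prefix p (s @ p)"
    by (rule prefix_length_prefix) auto
  ultimately show ?thesis by (simp add: returns_def)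
qed

lemma returns_concat:
  assumes "d \<le> length p" "p \<in> L" "set ts \<subseteq> returns p" shows "concat ts \<in> returns p"
  using assms(3)
proof (induction ts)
  case Nil
  show ?case using assms(2) by (simp add: returns_def)
next
  case (Cons t ts)
  then show ?case using returns_append[OF assms(1)] by simp
qed

lemma returns_mem: "t \<in> returns p \<Longrightarrow> t \<in> L"
  by (auto simp: returns_def intro: prefix_mem)

end

section \<open>Code words with recognizable endings, and the automaton of a suffix code\<close>

lemma concat_replicate_period: "has_period (length x) (concat (replicate k x))"
proof (rule has_period_if_shift)
  show "x @ concat (replicate k x) = concat (replicate k x) @ x"
    by (induction k) auto
qed

lemma concat_replicate_add:
  "concat (replicate (k + l) x) = concat (replicate k x) @ concat (replicate l x)"
  by (simp add: replicate_add)

text \<open>If the exponents differed, cancelling the smaller power of \<open>x\<close> would leave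
  a word ending in both \<open>x\<close> and \<open>y\<close>. Two suffixes of one word are
  comparable, contrary to \<open>xy\<close>.\<close>

lemma marker_unique:
  assumes xy: "\<not> suffix x y" "\<not> suffix y x"
    and s: "suffix (y @ concat (replicate k x)) (r @ y @ concat (replicate l x))"
  shows "k = l"
proof (rule linorder_cases)
  assume "k < l"
  then obtain m where "l = Suc (k + m)" using less_imp_Suc_add by blast
  then have l: "l = m + 1 + k" by simp
  have "suffix (y @ concat (replicate k x)) ((r @ y @ concat (replicate m x) @ x) @ concat (replicate k x))"
    using s unfolding l concat_replicate_add by simp
  then have "suffix y (r @ y @ concat (replicate m x) @ x)" unfolding suffix_def by auto
  moreover have "suffix x ((r @ y @ concat (replicate m x)) @ x)" by (rule suffixI[OF refl])
  ultimately show ?thesis using xy suffix_same_cases[of y _ x] by auto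
next
  assume "l < k"
  then obtain m where "k = Suc (l + m)" using less_imp_Suc_add by blast
  then have k: "k = m + 1 + l" by simp
  have "suffix ((y @ concat (replicate m x) @ x) @ concat (replicate l x)) ((r @ y) @ concat (replicate l x))"
    using s unfolding k concat_replicate_add by simp
  then have "suffix (y @ concat (replicate m x) @ x) (r @ y)" unfolding suffix_def by auto
  then have "suffix x (r @ y)" unfolding suffix_def by (metis append.assoc)
  moreover have "suffix y (r @ y)" by (rule suffixI[OF refl])
  ultimately show ?thesis using xy suffix_same_cases by blast
qed

context finite_type_language
begin

text \<open>All code words \<open>U w @ w @ V w\<close> are returns to one word \<open>p\<close>, so
  their products stay in \<open>L\<close>. \<open>U w\<close> contains an aperiodic word, and
  \<open>V w\<close> ends in a fixed \<open>y\<close> followed by a power of \<open>x\<close> whose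
  exponent numbers \<open>w\<close>.\<close>

lemma markers_exist:
  assumes aperiodic: "\<And>N. \<exists>u\<in>L. \<forall>q. 0 < q \<longrightarrow> q \<le> N \<longrightarrow> \<not> has_period q u"
  obtains U V :: "'a list \<Rightarrow> 'a list"
  where "\<And>w q. w \<in> L \<Longrightarrow> 0 < q \<Longrightarrow> q \<le> length w \<Longrightarrow> \<not> has_period q (U w)"
    and "\<And>w. w \<in> L \<Longrightarrow> V w \<noteq> []"
    and "\<And>w w'. w \<in> L \<Longrightarrow> w' \<in> L \<Longrightarrow> suffix (V w) (U w' @ w' @ V w') \<Longrightarrow> w = w'"
    and "\<And>gs. set gs \<subseteq> (\<lambda>w. U w @ w @ V w) ` L \<Longrightarrow> concat gs \<in> L"
proof -
  \<comment> \<open>The bound \<open>max d 1\<close> yields both \<open>d \<le> length p\<close> and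
    \<open>p \<noteq> []\<close>, because every \<open>q\<close> of at least \<open>length p\<close>
    is a period.\<close>
  obtain p where p: "p \<in> L" "\<forall>q. 0 < q \<longrightarrow> q \<le> max d 1 \<longrightarrow> \<not> has_period q p"
    using aperiodic by blast
  have "\<not> has_period (max d 1) p" using p(2) by simp
  then have len: "d \<le> length p" "p \<noteq> []" unfolding has_period_def by auto
  obtain s where "p @ s @ p \<in> L" using irreducible p(1) by blast
  then have "p @ s \<in> returns p \<and> p @ s \<noteq> []" using len by (simp add: returns_def)
  then obtain x where x: "x \<in> returns p" "x \<noteq> []"
    and x_min: "\<And>t. t \<in> returns p \<Longrightarrow> t \<noteq> [] \<Longrightarrow> length x \<le> length t"
    using ex_has_least_nat[of "\<lambda>t. t \<in> returns p \<and> t \<noteq> []" "p @ s" length] by blast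
  \<comment> \<open>A path from \<open>p\<close> through an aperiodic word and then \<open>w\<close>
    back to \<open>p\<close> gives a return. A word with an aperiodic factor is itself aperiodic up
    to the same bound.\<close>
  have embed: "\<exists>u s. u @ w @ s \<in> returns p \<and> (\<forall>q. 0 < q \<longrightarrow> q \<le> N \<longrightarrow> \<not> has_period q u)"
    if w: "w \<in> L" for w N
  proof -
    obtain u where u: "u \<in> L" "\<forall>q. 0 < q \<longrightarrow> q \<le> N \<longrightarrow> \<not> has_period q u"
      using aperiodic by blast
    obtain s1 where s1: "p @ s1 @ u \<in> L" using irreducible[OF p(1) u(1)] by blast
    obtain s2 where s2: "(p @ s1 @ u) @ s2 @ w \<in> L" using irreducible[OF s1 w] by blast
    obtain s3 where s3: "((p @ s1 @ u) @ s2 @ w) @ s3 @ p \<in> L" using irreducible[OF s2 p(1)] by blast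
    have "(p @ s1 @ u @ s2) @ w @ s3 \<in> returns p" using s3 by (simp add: returns_def)
    moreover have "\<forall>q. 0 < q \<longrightarrow> q \<le> N \<longrightarrow> \<not> has_period q (p @ s1 @ u @ s2)"
      using u(2) has_period_factor[of _ "p @ s1" u s2] by auto
    ultimately show ?thesis by blast
  qed
  \<comment> \<open>A return that starts with a word lacking the period \<open>length x\<close>
    cannot be a power of \<open>x\<close>.\<close>
  obtain y0 s0 where y0: "y0 @ [] @ s0 \<in> returns p" "\<not> has_period (length x) y0"
    using embed[OF Nil_mem, of "length x"] x(2) by auto
  have "y0 @ s0 \<noteq> concat (replicate k x)" for k
    using y0(2) concat_replicate_period[of x k] has_period_factor[of "length x" "[]" y0 s0] by auto
  then have "y0 @ s0 \<in> returns p \<and> (\<forall>k. y0 @ s0 \<noteq> concat (replicate k x))" using y0(1) by simp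
  then obtain y where y: "y \<in> returns p" "\<And>k. y \<noteq> concat (replicate k x)"
    and y_min: "\<And>t. t \<in> returns p \<Longrightarrow> (\<And>k. t \<noteq> concat (replicate k x)) \<Longrightarrow> length y \<le> length t"
    using ex_has_least_nat[of "\<lambda>t. t \<in> returns p \<and> (\<forall>k. t \<noteq> concat (replicate k x))" "y0 @ s0" length]
    by blast
  \<comment> \<open>If \<open>x\<close> were a suffix of \<open>y\<close>, cancelling it would leave
    a shorter return that is still no power of \<open>x\<close>. Conversely \<open>y\<close> is at
    least as long as \<open>x\<close>, so as a suffix of \<open>x\<close> it would equal
    \<open>x\<close>.\<close>
  have xy: "\<not> suffix x y"
  proof
    assume "suffix x y"
    then obtain t where t: "y = t @ x" by (auto simp: suffix_def)
    have "t \<noteq> concat (replicate k x)" for k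
      using y(2)[of "k + 1"] unfolding t concat_replicate_add by simp
    moreover have "t \<in> returns p" using y(1) x(1) unfolding t by (rule returns_cancel)
    ultimately have "length y \<le> length t" using y_min by blast
    then show False using t x(2) by simp
  qed
  have yx: "\<not> suffix y x"
  proof
    assume s: "suffix y x"
    have "y \<noteq> []" using y(2)[of 0] by simp
    then have "length x \<le> length y" using x_min y(1) by blast
    with s have "y = x" by (metis le_antisym suffix_length_le suffix_def append_eq_append_conv append_Nil)
    then show False using y(2)[of 1] by simp
  qed
  have "\<forall>w\<in>L. \<exists>us. fst us @ w @ snd us \<in> returns p \<and>
      (\<forall>q. 0 < q \<longrightarrow> q \<le> length w \<longrightarrow> \<not> has_period q (fst us))"
    using embed by simp
  then obtain F where F: "\<And>w. w \<in> L \<Longrightarrow> fst (F w) @ w @ snd (F w) \<in> returns p"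
    "\<And>w q. w \<in> L \<Longrightarrow> 0 < q \<Longrightarrow> q \<le> length w \<Longrightarrow> \<not> has_period q (fst (F w))"
    by metis
  \<comment> \<open>The exponent \<open>to_nat w\<close> labels \<open>w\<close>, and
    \<open>y\<close> marks where the power of \<open>x\<close> begins.\<close>
  define V where "V w = snd (F w) @ y @ concat (replicate (to_nat w) x)" for w
  show thesis
  proof
    show "\<not> has_period q (fst (F w))" if "w \<in> L" "0 < q" "q \<le> length w" for w q
      using F(2) that .
    show "V w \<noteq> []" for w using y(2)[of 0] by (simp add: V_def)
    show "w = w'" if "suffix (V w) (fst (F w') @ w' @ V w')" for w w'
    proof -
      have "suffix (y @ concat (replicate (to_nat w) x)) (V w)" by (simp add: V_def suffix_def)
      with that have "suffix (y @ concat (replicate (to_nat w) x))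
          ((fst (F w') @ w' @ snd (F w')) @ y @ concat (replicate (to_nat w') x))"
        by (metis V_def append.assoc suffix_order.trans)
      then show ?thesis using marker_unique[OF xy yx] by fastforce
    qed
    fix gs assume gs: "set gs \<subseteq> (\<lambda>w. fst (F w) @ w @ V w) ` L"
    have x_power: "concat (replicate k x) \<in> returns p" for k
      using x(1) by (intro returns_concat[OF len(1) p(1)]) (auto split: if_splits)
    have "fst (F w) @ w @ V w \<in> returns p" if "w \<in> L" for w
    proof -
      have "concat [fst (F w) @ w @ snd (F w), y, concat (replicate (to_nat w) x)] \<in> returns p"
        using len p(1) F(1)[OF that] y(1) x_power
        by (intro returns_concat) auto
      then show ?thesis by (simp add: V_def)
    qed
    then have "set gs \<subseteq> returns p" using gs by blast
    then show "concat gs \<in> L" by (rule returns_mem[OF returns_concat[OF len(1) p(1)]])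
  qed
qed

end

text \<open>Words are read from right to left; the state remembers the suffix of a code word read so far.\<close>

primrec code_state :: "'a list set \<Rightarrow> 'a list \<Rightarrow> 'a list option" where
  "code_state G [] = Some []"
| "code_state G (a # w) = (case code_state G w of None \<Rightarrow> None | Some s \<Rightarrow>
     if a # s \<in> G then Some [] else if \<exists>g\<in>G. suffix (a # s) g then Some (a # s) else None)"

lemma code_state_append_cong:
  "code_state G w = code_state G w' \<Longrightarrow> code_state G (u @ w) = code_state G (u @ w')"
  by (induction u) auto

lemma code_state_append_None: "code_state G w = None \<Longrightarrow> code_state G (u @ w) = None"
  by (induction u) auto

text \<open>Exhibits the surviving words as suffixes of products of code words, which is how they
  are seen to lie in the language.\<close>

lemma code_state_decomp:
  assumes "code_state G w = Some s"
  shows "\<exists>gs. set gs \<subseteq> G \<and> w = s @ concat gs \<and> (s = [] \<or> (\<exists>g\<in>G. suffix s g))"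
  using assms
proof (induction w arbitrary: s)
  case Nil
  then show ?case by (intro exI[of _ "[]"]) auto
next
  case (Cons a w)
  then obtain t where t: "code_state G w = Some t" by (auto split: option.splits)
  then obtain gs where gs: "set gs \<subseteq> G" "w = t @ concat gs" using Cons.IH by blast
  show ?case
  proof (cases "a # t \<in> G")
    case True
    then have "s = []" using Cons.prems t by simp
    with True gs show ?thesis by (intro exI[of _ "(a # t) # gs"]) auto
  next
    case False
    then have "s = a # t" "\<exists>g\<in>G. suffix s g" using Cons.prems t by (auto split: if_splits)
    with gs show ?thesis by (intro exI[of _ gs]) auto
  qed
qed

text \<open>On a proper suffix of \<open>g\<close> the state is never reset, since a code word that
  is a suffix of \<open>g\<close> is all of \<open>g\<close>.\<close>

lemma code_state_suffix:
  assumes code: "\<forall>g\<in>G. \<forall>g'\<in>G. suffix g g' \<longrightarrow> g = g'"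
    and g: "g \<in> G" "suffix s g" "s \<noteq> g"
  shows "code_state G s = Some s"
  using g(2,3)
proof (induction s)
  case (Cons a s)
  have "suffix s g" using Cons.prems(1) by (meson suffix_ConsI suffix_order.refl suffix_order.trans)
  moreover have "s \<noteq> g" using Cons.prems(1) suffix_length_le by fastforce
  ultimately have "code_state G s = Some s" using Cons.IH by blast
  moreover have "a # s \<notin> G" using code g(1) Cons.prems by blast
  ultimately show ?case using Cons.prems(1) g(1) by auto
qed simp

text \<open>Until all of \<open>g\<close> is read, the state is the whole word read so far. The next
  letter must extend it to a suffix of some code word, and that code word ends in \<open>v\<close>,
  so it can only be \<open>g\<close>.\<close>

lemma code_state_marked:
  assumes code: "\<forall>g\<in>G. \<forall>g'\<in>G. suffix g g' \<longrightarrow> g = g'"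
    and g: "g \<in> G" "suffix v g"
    and unique: "\<forall>g'\<in>G. suffix v g' \<longrightarrow> g' = g"
    and r: "code_state G (r @ v) \<noteq> None" "length (r @ v) \<le> length g"
  shows "suffix (r @ v) g"
  using r
proof (induction r)
  case (Cons a r)
  have "code_state G (r @ v) \<noteq> None"
  proof
    assume "code_state G (r @ v) = None"
    then show False using Cons.prems(1) by simp
  qed
  then have s: "suffix (r @ v) g" using Cons.IH Cons.prems(2) by simp
  have "r @ v \<noteq> g" using Cons.prems(2) by auto
  then have "code_state G (r @ v) = Some (r @ v)" using code_state_suffix[OF code g(1) s] by blast
  then have "\<exists>g'\<in>G. suffix (a # r @ v) g'" using Cons.prems(1) by (auto split: if_splits)
  then obtain g' where g': "g' \<in> G" "suffix (a # r @ v) g'" by blast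
  moreover have "suffix v (a # r @ v)" by (rule suffixI[of _ "a # r"]) simp
  ultimately have "suffix v g'" by (meson suffix_order.trans)
  then show ?case using unique g' by auto
qed (use g in simp)

text \<open>The marker \<open>V w\<close> singles out one code word, so a surviving
  \<open>U w @ w' @ V w\<close> with \<open>w'\<close> no longer than \<open>w\<close> has to follow
  it. The missing short periods of \<open>U w\<close> then leave only \<open>w' = w\<close>.\<close>

lemma (in finite_type_language) separating_automaton:
  assumes aperiodic: "\<And>N. \<exists>u\<in>L. \<forall>q. 0 < q \<longrightarrow> q \<le> N \<longrightarrow> \<not> has_period q u"
  obtains G where "\<And>w. code_state G w \<noteq> None \<Longrightarrow> w \<in> L"
    and "\<And>w. w \<in> L \<Longrightarrow> \<exists>u v. code_state G (u @ w @ v) = Some [] \<and>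
           (\<forall>w'. length w' \<le> length w \<longrightarrow> w' \<noteq> w \<longrightarrow> code_state G (u @ w' @ v) = None)"
proof -
  obtain U V where U: "\<And>w q. w \<in> L \<Longrightarrow> 0 < q \<Longrightarrow> q \<le> length w \<Longrightarrow> \<not> has_period q (U w)"
    and V: "\<And>w. w \<in> L \<Longrightarrow> V w \<noteq> []"
    and inj: "\<And>w w'. w \<in> L \<Longrightarrow> w' \<in> L \<Longrightarrow> suffix (V w) (U w' @ w' @ V w') \<Longrightarrow> w = w'"
    and conc: "\<And>gs. set gs \<subseteq> (\<lambda>w. U w @ w @ V w) ` L \<Longrightarrow> concat gs \<in> L"
    by (rule markers_exist[OF aperiodic]) (rule that)
  define G where "G = (\<lambda>w. U w @ w @ V w) ` L"
  have V_suffix: "suffix (V w) (U w @ w @ V w)" for w by (rule suffixI[of _ "U w @ w"]) simp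
  have unique: "g = U w @ w @ V w" if "w \<in> L" "g \<in> G" "suffix (V w) g" for w g
    using that inj unfolding G_def by blast
  have code: "\<forall>g\<in>G. \<forall>g'\<in>G. suffix g g' \<longrightarrow> g = g'"
  proof (intro ballI impI)
    fix g g' assume g: "g \<in> G" "g' \<in> G" "suffix g g'"
    obtain w where w: "w \<in> L" "g = U w @ w @ V w" using g(1) unfolding G_def by blast
    then have "suffix (V w) g'" using V_suffix g(3) suffix_order.trans by blast
    then show "g = g'" using unique w g(2) by blast
  qed
  show thesis
  proof
    fix w assume "code_state G w \<noteq> None"
    then obtain s gs where gs: "set gs \<subseteq> G" "w = s @ concat gs" "s = [] \<or> (\<exists>g\<in>G. suffix s g)"
      using code_state_decomp by blast
    from gs(3) show "w \<in> L"
    proof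
      assume "s = []"
      then show ?thesis using conc gs unfolding G_def by simp
    next
      assume "\<exists>g\<in>G. suffix s g"
      then obtain r where "r @ s \<in> G" by (auto simp: suffix_def)
      then have "concat ((r @ s) # gs) \<in> L" using conc gs(1) unfolding G_def by (intro conc) auto
      then have "r @ w \<in> L" using gs(2) by simp
      then show ?thesis by (rule suffix_mem)
    qed
  next
    fix w assume w: "w \<in> L"
    let ?g = "U w @ w @ V w"
    have gG: "?g \<in> G" using w by (simp add: G_def)
    obtain a s where as: "?g = a # s" using V[OF w] by (cases ?g) auto
    \<comment> \<open>Without its first letter the code word is a proper suffix, which the state
      records in full. Reading the remaining letter completes the code word and resets the
      state.\<close>
    have "code_state G s = Some s"
      by (rule code_state_suffix[OF code gG]) (simp_all add: as suffix_def)
    then have "code_state G ?g = Some []" using gG unfolding as by simp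
    moreover have "code_state G (U w @ w' @ V w) = None"
      if w': "length w' \<le> length w" "w' \<noteq> w" for w'
    proof (rule ccontr)
      assume "\<not> ?thesis"
      then have "code_state G ((U w @ w') @ V w) \<noteq> None" by simp
      moreover have "\<forall>g\<in>G. suffix (V w) g \<longrightarrow> g = ?g" using unique[OF w] by blast
      ultimately have "suffix ((U w @ w') @ V w) ?g"
        using w'(1) by (intro code_state_marked[OF code gG V_suffix]) auto
      \<comment> \<open>Comparing right ends gives \<open>w = y @ w'\<close>, and the two copies of
        \<open>U w\<close> then overlap with shift \<open>length y\<close>. As
        \<open>w' \<noteq> w\<close>, this is a positive period of \<open>U w\<close> of at most
        \<open>length w\<close>.\<close>
      then obtain z where z: "z @ U w @ w' = U w @ w"
        by (auto simp: suffix_def)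
      have "suffix w' (U w @ w)" by (rule suffixI[of _ "z @ U w"]) (simp add: z)
      moreover have "suffix w (U w @ w)" by (rule suffixI[OF refl])
      ultimately have "suffix w' w" using w'(1) by (rule suffix_length_suffix)
      then obtain y where y: "w = y @ w'" by (auto simp: suffix_def)
      then have zy: "z @ U w = U w @ y" using z by simp
      then have "length (z @ U w) = length (U w @ y)" by (rule arg_cong)
      then have "length z = length y" by simp
      with has_period_if_shift[OF zy] have "has_period (length y) (U w)" by simp
      moreover have "0 < length y" "length y \<le> length w" using y w'(2) by auto
      ultimately show False using U[OF w] by blast
    qed
    ultimately show "\<exists>u v. code_state G (u @ w @ v) = Some [] \<and>
        (\<forall>w'. length w' \<le> length w \<longrightarrow> w' \<noteq> w \<longrightarrow> code_state G (u @ w' @ v) = None)"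
      by blast
  qed
qed

section \<open>Algebras of irreducible languages\<close>

text \<open>Factorizations \<open>x @ z = u\<close> correspond to cut positions of \<open>u\<close>.
  This passes between products indexed by positions and sums over supports.\<close>

lemma sum_splittings:
  fixes F :: "'a list \<Rightarrow> 'a list \<Rightarrow> 'b::comm_monoid_add"
  assumes "finite A" "finite B"
    and "\<And>x z. x @ z = u \<Longrightarrow> F x z \<noteq> 0 \<Longrightarrow> x \<in> A \<and> z \<in> B"
  shows "(\<Sum>i\<le>length u. F (take i u) (drop i u)) = (\<Sum>x\<in>A. \<Sum>z\<in>B. if x @ z = u then F x z else 0)"
proof -
  let ?P = "(\<lambda>i. (take i u, drop i u)) ` {..length u}"
  have P: "p \<in> ?P" if "fst p @ snd p = u" for p
    using that by (intro image_eqI[of _ _ "length (fst p)"]) (auto simp: prod_eq_iff)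
  have "inj_on (\<lambda>i. (take i u, drop i u)) {..length u}"
    by (rule inj_on_inverseI[of _ "\<lambda>p. length (fst p)"]) auto
  then have "(\<Sum>i\<le>length u. F (take i u) (drop i u)) = (\<Sum>p\<in>?P. F (fst p) (snd p))"
    by (simp add: sum.reindex)
  also have "\<dots> = (\<Sum>p\<in>?P \<union> A \<times> B. if fst p @ snd p = u then F (fst p) (snd p) else 0)"
    using assms P by (intro sum.mono_neutral_cong_left) auto
  also have "\<dots> = (\<Sum>p\<in>A \<times> B. if fst p @ snd p = u then F (fst p) (snd p) else 0)"
    using assms by (intro sum.mono_neutral_right) auto
  also have "\<dots> = (\<Sum>x\<in>A. \<Sum>z\<in>B. if x @ z = u then F x z else 0)"
    by (simp add: sum.cartesian_product case_prod_unfold)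
  finally show ?thesis .
qed

text \<open>For a factor-closed \<open>L\<close> this is the free algebra modulo the span of the
  words outside \<open>L\<close>: products leaving \<open>L\<close> are truncated to zero.\<close>

definition lang_alg :: "'a list set \<Rightarrow> ('a list \<Rightarrow> 'k::field) ring" where
  "lang_alg L = \<lparr> carrier = {f. finite {w. f w \<noteq> 0} \<and> (\<forall>w. f w \<noteq> 0 \<longrightarrow> w \<in> L)},
      monoid.mult = (\<lambda>f g u. if u \<in> L then \<Sum>i\<le>length u. f (take i u) * g (drop i u) else 0),
      one = (\<lambda>w. if w = [] then 1 else 0),
      zero = (\<lambda>w. 0),
      add = (\<lambda>f g w. f w + g w) \<rparr>"

lemma lang_alg_simps:
  "carrier (lang_alg L) = {f. finite {w. f w \<noteq> 0} \<and> (\<forall>w. f w \<noteq> 0 \<longrightarrow> w \<in> L)}"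
  "f \<otimes>\<^bsub>lang_alg L\<^esub> g = (\<lambda>u. if u \<in> L then \<Sum>i\<le>length u. f (take i u) * g (drop i u) else 0)"
  "\<one>\<^bsub>lang_alg L\<^esub> = (\<lambda>w. if w = [] then 1 else 0)"
  "\<zero>\<^bsub>lang_alg L\<^esub> = (\<lambda>w. 0)"
  "f \<oplus>\<^bsub>lang_alg L\<^esub> g = (\<lambda>w. f w + g w)"
  by (simp_all add: lang_alg_def)

section \<open>Left ideals and maximal left ideals\<close>

lemma (in ring) left_idealI:
  assumes "J \<subseteq> carrier R" "J \<noteq> {}"
    and "\<And>x y. x \<in> J \<Longrightarrow> y \<in> J \<Longrightarrow> x \<oplus> y \<in> J"
    and mult: "\<And>r x. r \<in> carrier R \<Longrightarrow> x \<in> J \<Longrightarrow> r \<otimes> x \<in> J"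
  shows "left_ideal J R"
proof -
  have "\<ominus> x \<in> J" if "x \<in> J" for x
  proof -
    have "(\<ominus> \<one>) \<otimes> x \<in> J" using that by (intro mult) auto
    then show ?thesis using assms(1) that l_minus[of \<one> x] by auto
  qed
  then have "subgroup J (add_monoid R)"
    using assms by (intro add.subgroupI) auto
  then show ?thesis using mult by (auto simp: left_ideal_def additive_subgroup_def)
qed

lemma (in ring) left_idealD:
  assumes "left_ideal J R"
  shows "J \<subseteq> carrier R" "\<zero> \<in> J"
    and "x \<in> J \<Longrightarrow> y \<in> J \<Longrightarrow> x \<oplus> y \<in> J"
    and "r \<in> carrier R \<Longrightarrow> x \<in> J \<Longrightarrow> r \<otimes> x \<in> J"
    and "x \<in> J \<Longrightarrow> y \<in> J \<Longrightarrow> x \<ominus> y \<in> J"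
proof -
  interpret additive_subgroup J R using assms by (simp add: left_ideal_def)
  show "J \<subseteq> carrier R" "\<zero> \<in> J" "x \<in> J \<Longrightarrow> y \<in> J \<Longrightarrow> x \<oplus> y \<in> J"
    by (auto simp: a_subset)
  show "r \<in> carrier R \<Longrightarrow> x \<in> J \<Longrightarrow> r \<otimes> x \<in> J" using assms by (simp add: left_ideal_def)
  show "x \<in> J \<Longrightarrow> y \<in> J \<Longrightarrow> x \<ominus> y \<in> J" by (simp add: a_minus_def a_inv_closed)
qed

lemma (in ring) left_ideal_one: "left_ideal J R \<Longrightarrow> \<one> \<in> J \<Longrightarrow> J = carrier R"
  using left_idealD(1,4)[of J] r_one by fastforce

text \<open>Zorn's lemma applies because a left ideal is proper exactly when it misses 1, a property
  that survives unions of chains.\<close>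

lemma (in ring) maximal_left_ideal_exists:
  assumes "left_ideal J R" "\<one> \<notin> J"
  shows "\<exists>M. left_ideal M R \<and> J \<subseteq> M \<and> M \<noteq> carrier R \<and>
    (\<forall>L'. left_ideal L' R \<and> M \<subseteq> L' \<longrightarrow> L' = M \<or> L' = carrier R)"
proof -
  let ?A = "{M. left_ideal M R \<and> J \<subseteq> M \<and> \<one> \<notin> M}"
  have "\<exists>M\<in>?A. \<forall>X\<in>?A. M \<subseteq> X \<longrightarrow> X = M"
  proof (rule subset_Zorn_nonempty)
    show "?A \<noteq> {}" using assms by blast
    fix C assume C: "C \<noteq> {}" "subset.chain ?A C"
    then have CA: "\<And>M. M \<in> C \<Longrightarrow> left_ideal M R \<and> J \<subseteq> M \<and> \<one> \<notin> M"
      and chain: "\<And>X Y. X \<in> C \<Longrightarrow> Y \<in> C \<Longrightarrow> X \<subseteq> Y \<or> Y \<subseteq> X"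
      unfolding subset.chain_def by blast+
    have "left_ideal (\<Union>C) R"
    proof (rule left_idealI)
      show "\<Union>C \<subseteq> carrier R" using CA left_idealD(1) by blast
      show "\<Union>C \<noteq> {}" using CA left_idealD(2) C(1) by blast
      show "r \<otimes> x \<in> \<Union>C" if "r \<in> carrier R" "x \<in> \<Union>C" for r x
        using that CA left_idealD(4) by blast
      fix x y assume "x \<in> \<Union>C" "y \<in> \<Union>C"
      then obtain M where "M \<in> C" "x \<in> M" "y \<in> M" using chain by blast
      then show "x \<oplus> y \<in> \<Union>C" using CA left_idealD(3) by blast
    qed
    then show "\<Union>C \<in> ?A" using CA C(1) by blast
  qed
  then obtain M where "M \<in> ?A" and max: "\<forall>X\<in>?A. M \<subseteq> X \<longrightarrow> X = M" by (rule bexE)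
  from \<open>M \<in> ?A\<close> have M: "left_ideal M R" "J \<subseteq> M" "\<one> \<notin> M" by simp_all
  show ?thesis
  proof (intro exI conjI allI impI)
    show "M \<noteq> carrier R" using M(3) by auto
    fix L' assume L': "left_ideal L' R \<and> M \<subseteq> L'"
    show "L' = M \<or> L' = carrier R"
    proof (cases "\<one> \<in> L'")
      case True
      then show ?thesis using L' left_ideal_one by blast
    next
      case False
      then have "L' \<in> ?A" using L' M(2) by auto
      then show ?thesis using L' max by simp
    qed
  qed (use M in auto)
qed

section \<open>Coordinates, primeness and linear functionals\<close>

text \<open>Working in any ring with coordinates in \<open>lang_alg L\<close> lets the results apply
  directly to the quotient of the theorem, without transport along isomorphisms.
  \<open>sm_closed\<close> is separate since \<open>kalg_iso\<close> constrains only the image of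
  \<open>sm c x\<close>.\<close>

locale monomial_alg = irreducible_language L + ring A
  for L :: "nat list set" and A (structure) +
  fixes sm :: "'k::field \<Rightarrow> 'b \<Rightarrow> 'b" and coeff :: "'b \<Rightarrow> nat list \<Rightarrow> 'k"
  assumes iso: "kalg_iso A sm (lang_alg L) malg_smult coeff"
    and sm_closed: "x \<in> carrier A \<Longrightarrow> sm c x \<in> carrier A"
begin

lemma coeff_hom: "coeff \<in> ring_hom A (lang_alg L)"
  and coeff_bij: "bij_betw coeff (carrier A) (carrier (lang_alg L))"
  using iso by (auto simp: kalg_iso_def ring_iso_def)

lemma coeff_finite: "x \<in> carrier A \<Longrightarrow> finite {w. coeff x w \<noteq> 0}"
  and coeff_mem: "x \<in> carrier A \<Longrightarrow> coeff x w \<noteq> 0 \<Longrightarrow> w \<in> L"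
  using ring_hom_closed[OF coeff_hom] by (auto simp: lang_alg_simps)

lemma coeff_mult:
  "x \<in> carrier A \<Longrightarrow> y \<in> carrier A \<Longrightarrow>
   coeff (x \<otimes> y) u = (if u \<in> L then \<Sum>i\<le>length u. coeff x (take i u) * coeff y (drop i u) else 0)"
  by (simp add: ring_hom_mult[OF coeff_hom] lang_alg_simps)

lemma coeff_add: "x \<in> carrier A \<Longrightarrow> y \<in> carrier A \<Longrightarrow> coeff (x \<oplus> y) u = coeff x u + coeff y u"
  by (simp add: ring_hom_add[OF coeff_hom] lang_alg_simps)

lemma coeff_one: "coeff \<one> u = (if u = [] then 1 else 0)"
  by (simp add: ring_hom_one[OF coeff_hom] lang_alg_simps)

lemma coeff_zero: "coeff \<zero> u = 0"
proof -
  have "coeff \<zero> u = coeff \<zero> u + coeff \<zero> u"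
    using coeff_add[OF zero_closed zero_closed, of u] by (simp only: l_zero[OF zero_closed])
  then show ?thesis by (simp only: add_cancel_right_right)
qed

lemma coeff_minus: "x \<in> carrier A \<Longrightarrow> y \<in> carrier A \<Longrightarrow> coeff (x \<ominus> y) u = coeff x u - coeff y u"
proof -
  assume xy: "x \<in> carrier A" "y \<in> carrier A"
  then have "coeff (x \<ominus> y \<oplus> y) u = coeff (x \<ominus> y) u + coeff y u" by (intro coeff_add) auto
  moreover have "x \<ominus> y \<oplus> y = x" using xy by (simp add: a_minus_def a_assoc l_neg)
  ultimately show ?thesis by simp
qed

lemma coeff_sm: "x \<in> carrier A \<Longrightarrow> coeff (sm c x) u = c * coeff x u"
  using iso by (simp add: kalg_iso_def malg_smult_def)

lemma coeff_eqI:
  "x \<in> carrier A \<Longrightarrow> y \<in> carrier A \<Longrightarrow> (\<And>u. coeff x u = coeff y u) \<Longrightarrow> x = y"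
  using coeff_bij by (auto simp: bij_betw_def inj_on_def fun_eq_iff)

lemma nonzero_coeff: "x \<in> carrier A \<Longrightarrow> x \<noteq> \<zero> \<Longrightarrow> \<exists>w. coeff x w \<noteq> 0"
  using coeff_eqI[of x \<zero>] by (auto simp: coeff_zero)

lemma coeff_finsum:
  "finite S \<Longrightarrow> (\<And>s. s \<in> S \<Longrightarrow> g s \<in> carrier A) \<Longrightarrow> coeff (finsum A g S) u = (\<Sum>s\<in>S. coeff (g s) u)"
  by (induction S rule: finite_induct) (auto simp: coeff_zero coeff_add)

text \<open>The element \<open>c\<close> times \<open>w\<close>, pulled back along
  \<open>coeff\<close>. It is used only for \<open>w\<close> in \<open>L\<close>, where the
  pulled-back function lies in the image.\<close>

definition mono :: "'k \<Rightarrow> nat list \<Rightarrow> 'b" where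
  "mono c w = inv_into (carrier A) coeff (\<lambda>v. if v = w then c else 0)"

lemma
  assumes "w \<in> L"
  shows mono_closed: "mono c w \<in> carrier A"
    and coeff_mono: "coeff (mono c w) = (\<lambda>v. if v = w then c else 0)"
proof -
  have "(\<lambda>v. if v = w then c else 0) \<in> coeff ` carrier A"
    using assms coeff_bij by (auto simp: bij_betw_def lang_alg_simps)
  then show "mono c w \<in> carrier A" "coeff (mono c w) = (\<lambda>v. if v = w then c else 0)"
    unfolding mono_def by (auto intro: inv_into_into f_inv_into_f)
qed

lemma longest_coeff:
  assumes "x \<in> carrier A" "x \<noteq> \<zero>"
  obtains w where "coeff x w \<noteq> 0" "\<And>v. coeff x v \<noteq> 0 \<Longrightarrow> length v \<le> length w"
proof -
  let ?S = "{w. coeff x w \<noteq> 0}"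
  have S: "finite (length ` ?S)" "length ` ?S \<noteq> {}"
    using coeff_finite[OF assms(1)] nonzero_coeff[OF assms] by auto
  obtain w where "w \<in> ?S" "length w = Max (length ` ?S)"
    using Max_in[OF S] by auto
  then show thesis using Max_ge[OF S(1)] by (intro that[of w]) auto
qed

text \<open>Multiplying the longest words in the supports through a connecting word cannot cancel.\<close>

theorem prime: "prime_ring A"
  unfolding prime_ring_def
proof (intro conjI ballI impI)
  show "\<one> \<noteq> \<zero>" using coeff_one[of "[]"] coeff_zero[of "[]"] by auto
  fix a b assume a: "a \<in> carrier A" and b: "b \<in> carrier A"
    and ann: "\<forall>r\<in>carrier A. a \<otimes> r \<otimes> b = \<zero>"
  show "a = \<zero> \<or> b = \<zero>"
  proof (rule ccontr)
    assume "\<not> (a = \<zero> \<or> b = \<zero>)"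
    then obtain u v where u: "coeff a u \<noteq> 0" "\<And>w. coeff a w \<noteq> 0 \<Longrightarrow> length w \<le> length u"
      and v: "coeff b v \<noteq> 0" "\<And>w. coeff b w \<noteq> 0 \<Longrightarrow> length w \<le> length v"
      using longest_coeff[OF a] longest_coeff[OF b] by metis
    obtain s where s: "u @ s @ v \<in> L" using irreducible coeff_mem a b u(1) v(1) by blast
    then have "s \<in> L" "u @ s \<in> L" using suffix_mem prefix_mem[of "u @ s" v] by (auto intro: prefix_mem)
    note ms = mono_closed[OF \<open>s \<in> L\<close>, of 1] coeff_mono[OF \<open>s \<in> L\<close>, of 1]
    \<comment> \<open>Comparing lengths, \<open>u @ s\<close> can be cut with right part
      \<open>s\<close> only after \<open>u\<close>.\<close>
    have as: "coeff (a \<otimes> mono 1 s) (u @ s) = coeff a u"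
    proof -
      have "coeff (a \<otimes> mono 1 s) (u @ s)
          = (\<Sum>i\<le>length (u @ s). if i = length u then coeff a u else 0)"
      proof -
        have "drop i (u @ s) = s \<longleftrightarrow> i = length u" if "i \<le> length (u @ s)" for i
        proof
          assume "drop i (u @ s) = s"
          then have "length (drop i (u @ s)) = length s" by (rule arg_cong)
          with that show "i = length u" by simp
        qed simp
        then have "coeff a (take i (u @ s)) * coeff (mono 1 s) (drop i (u @ s))
            = (if i = length u then coeff a u else 0)" if "i \<le> length (u @ s)" for i
          using that unfolding ms(2) by (auto simp del: drop_append)
        then show ?thesis using \<open>u @ s \<in> L\<close> a ms(1)
          by (simp add: coeff_mult del: drop_append take_append)
      qed
      then show ?thesis by simp
    qed
    have as_len: "length w \<le> length (u @ s)" if "coeff (a \<otimes> mono 1 s) w \<noteq> 0" for w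
    proof -
      have "(\<Sum>i\<le>length w. coeff a (take i w) * coeff (mono 1 s) (drop i w)) \<noteq> 0"
        using that a ms by (auto simp: coeff_mult split: if_splits)
      then obtain i where "coeff a (take i w) \<noteq> 0" "drop i w = s" "i \<le> length w"
        using ms(2) by (auto elim!: sum.not_neutral_contains_not_neutral split: if_splits)
      with u(2)[of "take i w"] show ?thesis by (metis append_take_drop_id add_right_mono length_append)
    qed
    \<comment> \<open>A cut before the end of \<open>u @ s\<close> leaves a right part longer than
      every word of \<open>b\<close>. A later cut leaves a left part longer than every word of the
      first factor. A single nonzero term remains.\<close>
    have "coeff (a \<otimes> mono 1 s \<otimes> b) (u @ s @ v)
        = (\<Sum>i\<le>length (u @ s @ v). if i = length (u @ s) then coeff a u * coeff b v else 0)"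
    proof -
      have "coeff (a \<otimes> mono 1 s) (take i (u @ s @ v)) * coeff b (drop i (u @ s @ v))
          = (if i = length (u @ s) then coeff a u * coeff b v else 0)"
        if "i \<le> length (u @ s @ v)" for i
      proof (cases "i = length (u @ s)")
        case True
        have "take (length (u @ s)) ((u @ s) @ v) = u @ s" "drop (length (u @ s)) ((u @ s) @ v) = v"
          by simp_all
        then show ?thesis using as True by simp
      next
        case False
        then have "i < length (u @ s) \<or> length (u @ s) < i" by linarith
        then have "coeff b (drop i (u @ s @ v)) = 0 \<or> coeff (a \<otimes> mono 1 s) (take i (u @ s @ v)) = 0"
        proof (rule contrapos_pp)
          assume "\<not> (coeff b (drop i (u @ s @ v)) = 0 \<or> coeff (a \<otimes> mono 1 s) (take i (u @ s @ v)) = 0)"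
          then have "length (drop i (u @ s @ v)) \<le> length v"
            "length (take i (u @ s @ v)) \<le> length (u @ s)"
            using v(2) as_len by blast+
          then show "\<not> (i < length (u @ s) \<or> length (u @ s) < i)"
            using that by (simp del: take_append drop_append)
        qed
        then show ?thesis using False by auto
      qed
      then show ?thesis using s a b ms by (simp add: coeff_mult del: take_append drop_append)
    qed
    then have "coeff (a \<otimes> mono 1 s \<otimes> b) (u @ s @ v) \<noteq> 0" using u(1) v(1) by simp
    then show False using ann ms(1) coeff_zero by simp
  qed
qed

text \<open>The linear functional on \<open>A\<close> with value \<open>h w\<close> on each basis
  word \<open>w\<close>. Such functionals later serve as the coordinates of a module
  element.\<close>

definition pairing :: "(nat list \<Rightarrow> 'k) \<Rightarrow> 'b \<Rightarrow> 'k" where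
  "pairing h x = (\<Sum>w | coeff x w \<noteq> 0. h w * coeff x w)"

lemma pairing_eq:
  "finite B \<Longrightarrow> {w. coeff x w \<noteq> 0} \<subseteq> B \<Longrightarrow> pairing h x = (\<Sum>w\<in>B. h w * coeff x w)"
  unfolding pairing_def by (rule sum.mono_neutral_left) auto

lemma pairing_combine:
  assumes "x \<in> carrier A" "y \<in> carrier A"
  shows "pairing h (x \<oplus> y) = pairing h x + pairing h y"
    and "pairing h (x \<ominus> y) = pairing h x - pairing h y"
proof -
  let ?B = "{w. coeff x w \<noteq> 0} \<union> {w. coeff y w \<noteq> 0}"
  have B: "finite ?B" "{w. coeff x w \<noteq> 0} \<subseteq> ?B" "{w. coeff y w \<noteq> 0} \<subseteq> ?B"
    "{w. coeff (x \<oplus> y) w \<noteq> 0} \<subseteq> ?B" "{w. coeff (x \<ominus> y) w \<noteq> 0} \<subseteq> ?B"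
    using assms coeff_finite by (auto simp: coeff_add coeff_minus)
  note eqs = B(2-)[THEN pairing_eq[OF B(1)], of h]
  show "pairing h (x \<oplus> y) = pairing h x + pairing h y"
    unfolding eqs sum.distrib[symmetric] using assms by (simp add: coeff_add distrib_left)
  show "pairing h (x \<ominus> y) = pairing h x - pairing h y"
    unfolding eqs sum_subtractf[symmetric] using assms by (simp add: coeff_minus right_diff_distrib)
qed

lemma pairing_mono: "w \<in> L \<Longrightarrow> pairing h (mono c w) = h w * c"
  by (subst pairing_eq[of "{w}"]) (auto simp: coeff_mono split: if_splits)

lemma pairing_one: "pairing h \<one> = h []"
  by (subst pairing_eq[of "{[]}"]) (auto simp: coeff_one split: if_splits)

text \<open>The product discards concatenations outside \<open>L\<close>, and these contribute
  nothing on the right because \<open>h\<close> vanishes there.\<close>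

lemma pairing_mult:
  assumes x: "x \<in> carrier A" and y: "y \<in> carrier A" and h: "\<And>w. w \<notin> L \<Longrightarrow> h w = 0"
  shows "pairing h (x \<otimes> y) = pairing (\<lambda>u. pairing (\<lambda>w. h (u @ w)) y) x"
proof -
  let ?X = "{w. coeff x w \<noteq> 0}" and ?Y = "{w. coeff y w \<noteq> 0}"
  let ?Z = "(\<lambda>(u, w). u @ w) ` (?X \<times> ?Y)"
  have fin: "finite ?X" "finite ?Y" "finite ?Z" using x y coeff_finite by auto
  have xy: "coeff (x \<otimes> y) w = (\<Sum>u\<in>?X. \<Sum>v\<in>?Y. if u @ v = w then coeff x u * coeff y v else 0)"
    if "w \<in> L" for w
    using that x y fin sum_splittings[of ?X ?Y w "\<lambda>u v. coeff x u * coeff y v"]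
    by (simp add: coeff_mult)
  have "{w. coeff (x \<otimes> y) w \<noteq> 0} \<subseteq> ?Z"
  proof
    fix w assume w: "w \<in> {w. coeff (x \<otimes> y) w \<noteq> 0}"
    then have "w \<in> L" using coeff_mem x y by blast
    with w have "(\<Sum>u\<in>?X. \<Sum>v\<in>?Y. if u @ v = w then coeff x u * coeff y v else 0) \<noteq> 0"
      using xy by simp
    then obtain u where "u \<in> ?X" "(\<Sum>v\<in>?Y. if u @ v = w then coeff x u * coeff y v else 0) \<noteq> 0"
      by (rule sum.not_neutral_contains_not_neutral)
    moreover from this(2) obtain v where "v \<in> ?Y" "(if u @ v = w then coeff x u * coeff y v else 0) \<noteq> 0"
      by (rule sum.not_neutral_contains_not_neutral)
    ultimately show "w \<in> ?Z" by (auto split: if_splits)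
  qed
  then have "pairing h (x \<otimes> y) = (\<Sum>w\<in>?Z. h w * coeff (x \<otimes> y) w)"
    by (rule pairing_eq[OF fin(3)])
  also have "\<dots> = (\<Sum>w\<in>?Z. \<Sum>u\<in>?X. \<Sum>v\<in>?Y. if u @ v = w then h (u @ v) * (coeff x u * coeff y v) else 0)"
  proof (rule sum.cong[OF refl])
    fix w
    show "h w * coeff (x \<otimes> y) w
        = (\<Sum>u\<in>?X. \<Sum>v\<in>?Y. if u @ v = w then h (u @ v) * (coeff x u * coeff y v) else 0)"
    proof (cases "w \<in> L")
      case True
      then show ?thesis by (auto simp: xy sum_distrib_left intro!: sum.cong)
    next
      case False
      then have "h w = 0" by (rule h)
      then have "(if u @ v = w then h (u @ v) * (coeff x u * coeff y v) else 0) = 0" for u v by auto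
      then show ?thesis using \<open>h w = 0\<close> by simp
    qed
  qed
  also have "\<dots> = (\<Sum>u\<in>?X. \<Sum>v\<in>?Y. \<Sum>w\<in>?Z. if u @ v = w then h (u @ v) * (coeff x u * coeff y v) else 0)"
    by (subst sum.swap, rule sum.cong[OF refl], rule sum.swap)
  also have "\<dots> = (\<Sum>u\<in>?X. \<Sum>v\<in>?Y. h (u @ v) * (coeff x u * coeff y v))"
    by (intro sum.cong refl, subst sum.delta'[OF fin(3)]) auto
  also have "\<dots> = pairing (\<lambda>u. pairing (\<lambda>w. h (u @ w)) y) x"
    by (simp only: pairing_def sum_distrib_right sum_distrib_left mult_ac)
  finally show ?thesis .
qed

end

section \<open>Primitivity in the aperiodic case\<close>

locale finite_type_monomial_alg = monomial_alg L A sm coeff + finite_type_language L d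
  for L :: "nat list set" and A (structure) and sm :: "'k::field \<Rightarrow> 'b \<Rightarrow> 'b" and coeff d
begin

text \<open>The kernel of the action on the state reached from the empty word is a proper left ideal
  that is comaximal with every nonzero two-sided ideal.\<close>

theorem primitive:
  assumes aperiodic: "\<And>N. \<exists>u\<in>L. \<forall>q. 0 < q \<longrightarrow> q \<le> N \<longrightarrow> \<not> has_period q u"
  shows "primitive_ring A"
proof -
  obtain G where G_mem: "\<And>w. code_state G w \<noteq> None \<Longrightarrow> w \<in> L"
    and sep: "\<And>w. w \<in> L \<Longrightarrow> \<exists>u v. code_state G (u @ w @ v) = Some [] \<and>
           (\<forall>w'. length w' \<le> length w \<longrightarrow> w' \<noteq> w \<longrightarrow> code_state G (u @ w' @ v) = None)"
    by (rule separating_automaton[OF aperiodic]) (rule that)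
  \<comment> \<open>Let the states span a module on which words act by the automaton. Then
    \<open>pairing (h s) x\<close> is the coordinate at \<open>s\<close> of \<open>x\<close> applied
    to the initial state, and \<open>J\<close> below is the annihilator of that state.\<close>
  define h :: "nat list \<Rightarrow> nat list \<Rightarrow> 'k" where "h s w = (if code_state G w = Some s then 1 else 0)" for s w
  have h_L: "h s w = 0" if "w \<notin> L" for s w using that G_mem[of w] by (auto simp: h_def)
  define J where "J = {x \<in> carrier A. \<forall>s. pairing (h s) x = 0}"
  \<comment> \<open>Grouping the words of \<open>x\<close> by state gives a combination of
    coordinates that vanish on \<open>J\<close>. The group of dead words drops out because
    \<open>f None = 0\<close>.\<close>
  have J_state: "pairing (\<lambda>w. f (code_state G w)) x = 0" if x: "x \<in> J" and f: "f None = 0" for f x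
  proof -
    let ?X = "{w. coeff x w \<noteq> 0}"
    have fin: "finite ?X" using x coeff_finite by (simp add: J_def)
    have "pairing (\<lambda>w. f (code_state G w)) x
        = (\<Sum>t\<in>code_state G ` ?X. \<Sum>w\<in>{w \<in> ?X. code_state G w = t}. f (code_state G w) * coeff x w)"
      unfolding pairing_def by (rule sum.image_gen[OF fin])
    also have "\<dots> = 0"
    proof (rule sum.neutral, rule ballI)
      fix t
      have "(\<Sum>w\<in>{w \<in> ?X. code_state G w = t}. f (code_state G w) * coeff x w)
          = f t * (\<Sum>w\<in>{w \<in> ?X. code_state G w = t}. coeff x w)"
        unfolding sum_distrib_left by (intro sum.cong) auto
      also have "\<dots> = f t * (\<Sum>w\<in>?X. if code_state G w = t then coeff x w else 0)"
        by (simp only: sum.inter_filter[OF fin])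
      also have "\<dots> = 0"
      proof (cases t)
        case (Some s)
        have "(\<Sum>w\<in>?X. if code_state G w = t then coeff x w else 0) = pairing (h s) x"
          unfolding pairing_def Some h_def by (intro sum.cong) auto
        then show ?thesis using x by (simp add: J_def)
      qed (use f in simp)
      finally show "(\<Sum>w\<in>{w \<in> ?X. code_state G w = t}. f (code_state G w) * coeff x w) = 0" .
    qed
    finally show ?thesis .
  qed
  have J: "left_ideal J A"
  proof (rule left_idealI)
    show "J \<subseteq> carrier A" by (auto simp: J_def)
    have "\<zero> \<in> J" by (auto simp: J_def pairing_def coeff_zero)
    then show "J \<noteq> {}" by blast
    show "x \<oplus> y \<in> J" if "x \<in> J" "y \<in> J" for x y
      using that by (auto simp: J_def pairing_combine)
    fix r x assume r: "r \<in> carrier A" and x: "x \<in> J"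
    have xA: "x \<in> carrier A" using x by (simp add: J_def)
    have "pairing (h s) (r \<otimes> x) = 0" for s
    proof -
      have "pairing (\<lambda>w. h s (u @ w)) x = 0" for u
      proof -
        \<comment> \<open>The state after \<open>u @ w\<close> depends only on the state after
          \<open>w\<close>, so the functional factors through the state. Unreached states have no
          witness \<open>w\<close> and get the value 0.\<close>
        define f :: "nat list option \<Rightarrow> 'k" where
          "f t = (if \<exists>w. code_state G w = t \<and> code_state G (u @ w) = Some s then 1 else 0)" for t
        have "h s (u @ w) = f (code_state G w)" for w
          unfolding h_def f_def using code_state_append_cong[of G _ _ u] by (metis (mono_tags))
        moreover have "f None = 0"
          unfolding f_def using code_state_append_None[of G _ u] by auto
        ultimately show ?thesis using J_state[OF x, of f] by simp
      qed
      then show ?thesis using pairing_mult[OF r xA h_L] by (simp add: pairing_def)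
    qed
    then show "r \<otimes> x \<in> J" using r xA by (simp add: J_def)
  qed
  have one: "\<one> \<notin> J"
  proof
    assume "\<one> \<in> J"
    then have "pairing (h []) \<one> = 0" by (simp add: J_def)
    then show False by (simp add: pairing_one h_def)
  qed
  have comaximal: "\<exists>y\<in>I. y \<ominus> \<one> \<in> J" if I: "ideal I A" "I \<noteq> {\<zero>}" for I
  proof -
    interpret I: ideal I A by (rule I(1))
    obtain x where x: "x \<in> I" "x \<noteq> \<zero>" using I(2) I.zero_closed by blast
    have xA: "x \<in> carrier A" using x(1) I.a_subset by blast
    obtain w where w: "coeff x w \<noteq> 0" "\<And>v. coeff x v \<noteq> 0 \<Longrightarrow> length v \<le> length w"
      using longest_coeff[OF xA x(2)] by blast
    have "w \<in> L" using coeff_mem xA w(1) by blast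
    then obtain u v where uv: "code_state G (u @ w @ v) = Some []"
      "\<And>w'. length w' \<le> length w \<Longrightarrow> w' \<noteq> w \<Longrightarrow> code_state G (u @ w' @ v) = None"
      using sep by blast
    have L: "u @ w @ v \<in> L" using G_mem uv(1) by simp
    then have "u \<in> L" "w @ v \<in> L" by (auto intro: prefix_mem suffix_mem)
    then have "v \<in> L" by (auto intro: suffix_mem)
    define a where "a = mono (inverse (coeff x w)) u"
    define b where "b = mono 1 v"
    have a: "a \<in> carrier A" and b: "b \<in> carrier A"
      using mono_closed \<open>u \<in> L\<close> \<open>v \<in> L\<close> by (auto simp: a_def b_def)
    have y: "a \<otimes> x \<otimes> b \<in> I" using x(1) a b by (intro I.I_r_closed I.I_l_closed)
    \<comment> \<open>Between \<open>u\<close> and \<open>v\<close> only the longest word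
      \<open>w\<close> survives, and it leads back to the initial state. The scalar in
      \<open>a\<close> cancels its coefficient, so the product fixes the initial state.\<close>
    have "pairing (h s) (a \<otimes> x \<otimes> b) = h s []" for s
    proof -
      have "pairing (h s) (a \<otimes> x \<otimes> b) = pairing (\<lambda>p. h s (p @ v)) (a \<otimes> x)"
        using pairing_mult[of "a \<otimes> x" b "h s"] h_L a b xA \<open>v \<in> L\<close> by (simp add: b_def pairing_mono)
      also have "\<dots> = pairing (\<lambda>p. pairing (\<lambda>q. h s ((p @ q) @ v)) x) a"
        using h_L prefix_mem a xA by (intro pairing_mult) blast+
      also have "\<dots> = pairing (\<lambda>q. h s (u @ q @ v)) x * inverse (coeff x w)"
        using \<open>u \<in> L\<close> by (simp add: a_def pairing_mono)
      also have "pairing (\<lambda>q. h s (u @ q @ v)) x = (\<Sum>q | coeff x q \<noteq> 0. if q = w then h s [] * coeff x w else 0)"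
        unfolding pairing_def using uv w(2) by (intro sum.cong) (auto simp: h_def)
      also have "\<dots> = h s [] * coeff x w"
        using coeff_finite[OF xA] w(1) by simp
      finally show ?thesis using w(1) by simp
    qed
    then have "a \<otimes> x \<otimes> b \<ominus> \<one> \<in> J"
      using a b xA by (simp add: J_def pairing_combine pairing_one)
    with y show ?thesis by blast
  qed
  obtain M where M: "left_ideal M A" "J \<subseteq> M" "M \<noteq> carrier A"
    "\<forall>L'. left_ideal L' A \<and> M \<subseteq> L' \<longrightarrow> L' = M \<or> L' = carrier A"
    using maximal_left_ideal_exists[OF J one] by blast
  have "I = {\<zero>}" if I: "ideal I A" "I \<subseteq> M" for I
  proof (rule ccontr)
    assume "I \<noteq> {\<zero>}"
    \<comment> \<open>Both \<open>y\<close> and \<open>y \<ominus> \<one>\<close> lie in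
      \<open>M\<close>, hence so does their difference 1, although \<open>M\<close> is
      proper.\<close>
    then obtain y where y: "y \<in> I" "y \<ominus> \<one> \<in> J" using comaximal I(1) by blast
    then have "y \<in> M" "y \<ominus> \<one> \<in> M" using I(2) M(2) by auto
    then have "y \<ominus> (y \<ominus> \<one>) \<in> M" by (rule left_idealD(5)[OF M(1)])
    moreover have "y \<in> carrier A" using \<open>y \<in> M\<close> left_idealD(1)[OF M(1)] by blast
    then have "y \<ominus> (y \<ominus> \<one>) = \<one>"
      by (intro coeff_eqI) (auto simp: coeff_minus)
    ultimately show False using left_ideal_one[OF M(1)] M(3) by simp
  qed
  then show ?thesis unfolding primitive_ring_def using M by (intro exI[of _ M]) simp
qed

end

section \<open>Quotients isomorphic to a language algebra\<close>

text \<open>The ring axioms pass to a homomorphic image, so associativity of the truncated product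
  needs no separate computation.\<close>

lemma ring_lang_alg_if_image:
  fixes h :: "'b \<Rightarrow> 'a list \<Rightarrow> 'k::field"
  assumes "ring R" "h \<in> ring_hom R (lang_alg L)" "h ` carrier R = carrier (lang_alg L)"
    "h \<zero>\<^bsub>R\<^esub> = (\<lambda>w. 0)"
  shows "ring (lang_alg L :: ('a list \<Rightarrow> 'k) ring)"
proof -
  have "(lang_alg L :: ('a list \<Rightarrow> 'k) ring)\<lparr>carrier := h ` carrier R, zero := h \<zero>\<^bsub>R\<^esub>\<rparr> = lang_alg L"
    unfolding assms(3,4) by (simp add: lang_alg_def)
  with ring.ring_hom_imp_img_ring[OF assms(1,2)] show ?thesis by simp
qed

text \<open>The first isomorphism theorem, extended by the scalar action on cosets.\<close>

lemma quotient_kalg_iso: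
  fixes B :: "('c, 'd) ring_scheme"
  assumes R: "ring R" and B: "ring B" and h: "h \<in> ring_hom R B"
    and surj: "h ` carrier R = carrier B"
    and ker: "I = {x \<in> carrier R. h x = \<zero>\<^bsub>B\<^esub>}"
    and sm: "\<And>c x. x \<in> carrier R \<Longrightarrow> sm c x \<in> carrier R \<and> h (sm c x) = smB c (h x)"
  shows "ring (R Quot I)"
    and "kalg_iso (R Quot I) (quot_smult R I sm) B smB (\<lambda>X. the_elem (h ` X))"
    and "X \<in> carrier (R Quot I) \<Longrightarrow> quot_smult R I sm c X \<in> carrier (R Quot I)"
proof -
  interpret hom: ring_hom_ring R B h
    using R B h by (rule ring_hom_ringI2)
  have I: "I = a_kernel R B h" unfolding ker a_kernel_def' by (rule refl)
  have "ideal I R" unfolding I by (rule hom.kernel_is_ideal)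
  then interpret I: ideal I R .
  show "ring (R Quot I)" by (rule I.quotient_is_ring)
  have iso: "(\<lambda>X. the_elem (h ` X)) \<in> ring_iso (R Quot I) B"
    unfolding I using surj by (rule hom.FactRing_iso_set)
  have smult: "quot_smult R I sm c X \<in> carrier (R Quot I) \<and>
      the_elem (h ` quot_smult R I sm c X) = smB c (the_elem (h ` X))"
    if X: "X \<in> carrier (R Quot I)" for c X
  proof -
    obtain x where x: "x \<in> carrier R" "X = I +>\<^bsub>R\<^esub> x"
      using hom.quot_mem X unfolding I by blast
    have sub: "X \<subseteq> carrier R" using x I.a_subset hom.R.a_r_coset_subset_G by simp
    have hX: "h y = h x" if "y \<in> X" for y
      using that x unfolding I using hom.rcos_imp_homeq by blast
    \<comment> \<open>\<open>quot_smult\<close> is a union over all representatives. Scaled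
      representatives have the same image under \<open>h\<close>, so that union is a single
      coset.\<close>
    have "I +>\<^bsub>R\<^esub> sm c y = I +>\<^bsub>R\<^esub> sm c x" if "y \<in> X" for y
    proof -
      have y: "y \<in> carrier R" using that sub by blast
      have "h (sm c y) = h (sm c x)" using sm y x(1) hX[OF that] by simp
      then have "sm c y \<in> I +>\<^bsub>R\<^esub> sm c x"
        unfolding I using sm y x(1) by (intro hom.homeq_imp_rcos) auto
      then show ?thesis using I.a_repr_independence' sm x(1) by blast
    qed
    moreover have "x \<in> X" using x I.a_rcos_self by simp
    ultimately have q: "quot_smult R I sm c X = I +>\<^bsub>R\<^esub> sm c x"
      unfolding quot_smult_def by blast
    have "the_elem (h ` X) = h x" "the_elem (h ` (I +>\<^bsub>R\<^esub> sm c x)) = h (sm c x)"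
      using x sm unfolding I by simp_all
    then show ?thesis using q sm x(1) by (simp add: FactRing_simps) blast
  qed
  then show "X \<in> carrier (R Quot I) \<Longrightarrow> quot_smult R I sm c X \<in> carrier (R Quot I)" by blast
  show "kalg_iso (R Quot I) (quot_smult R I sm) B smB (\<lambda>X. the_elem (h ` X))"
    using iso smult by (simp add: kalg_iso_def)
qed

lemma kalg_iso_trans_sym:
  assumes A: "kalg_iso A smA B smB f" and C: "kalg_iso C smC B smB g" and "ring C"
    and smC: "\<And>c x. x \<in> carrier C \<Longrightarrow> smC c x \<in> carrier C"
  shows "kalg_iso A smA C smC (inv_into (carrier C) g \<circ> f)"
proof -
  have g: "bij_betw g (carrier C) (carrier B)" and f: "bij_betw f (carrier A) (carrier B)"
    using A C by (auto simp: kalg_iso_def ring_iso_def)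
  have "inv_into (carrier C) g \<circ> f \<in> ring_iso A C"
    using A C by (intro ring_iso_set_trans[of f A B] ring_iso_set_sym[OF \<open>ring C\<close>])
      (simp_all add: kalg_iso_def)
  moreover have "inv_into (carrier C) g (f (smA c x)) = smC c (inv_into (carrier C) g (f x))"
    if x: "x \<in> carrier A" for c x
  proof -
    have "f x \<in> carrier B" using f x by (auto simp: bij_betw_def)
    then obtain y where y: "y \<in> carrier C" "f x = g y" using g by (auto simp: bij_betw_def)
    have "f (smA c x) = g (smC c y)" using A C x y by (simp add: kalg_iso_def)
    then show ?thesis using y smC g by (simp add: bij_betw_def inv_into_f_f)
  qed
  ultimately show ?thesis by (simp add: kalg_iso_def)
qed

lemma ring_free_alg: "ring (free_alg n :: (nat list \<Rightarrow> 'k::field) ring)"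
  unfolding free_alg_def by (rule malg_ring) auto

definition restrict_to :: "'a set \<Rightarrow> ('a \<Rightarrow> 'k::field) \<Rightarrow> 'a \<Rightarrow> 'k" where
  "restrict_to L f = (\<lambda>w. if w \<in> L then f w else 0)"

text \<open>Restriction to a factor-closed \<open>L\<close> is multiplicative, since both parts of a
  cut word of \<open>L\<close> lie in \<open>L\<close>. Its kernel consists of the finite
  combinations of words outside \<open>L\<close>, which is the ideal generated by those
  words.\<close>

lemma free_alg_monomial_quotient:
  fixes L :: "nat list set"
  assumes irr: "irreducible_language L" and L: "L \<subseteq> lists {1..n}"
  defines "F \<equiv> (free_alg n :: (nat list \<Rightarrow> 'k::field) ring)"
  defines "I \<equiv> genideal F (word_elem ` (lists {1..n} - L))"
  shows "ring (lang_alg L :: (nat list \<Rightarrow> 'k) ring)" and "ring (F Quot I)"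
    and "kalg_iso (F Quot I) (quot_smult F I malg_smult) (lang_alg L) malg_smult
      (\<lambda>X. the_elem (restrict_to L ` X))"
    and "X \<in> carrier (F Quot I) \<Longrightarrow> quot_smult F I malg_smult c X \<in> carrier (F Quot I)"
proof -
  interpret irreducible_language L by (rule irr)
  interpret F: ring F unfolding F_def by (rule ring_free_alg)
  have carr: "carrier F = {f. finite {w. f w \<noteq> 0} \<and> (\<forall>w. f w \<noteq> 0 \<longrightarrow> w \<in> lists {1..n})}"
    by (simp add: F_def free_alg_def malg_simps)
  have zero: "\<zero>\<^bsub>F\<^esub> = (\<lambda>w. 0)" and one: "\<one>\<^bsub>F\<^esub> = (\<lambda>w. if w = [] then 1 else 0)"
    and add: "\<And>f g. f \<oplus>\<^bsub>F\<^esub> g = (\<lambda>w. f w + g w)"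
    by (simp_all add: F_def free_alg_def malg_simps)
  have mult: "(f \<otimes>\<^bsub>F\<^esub> g) u = (\<Sum>i\<le>length u. f (take i u) * g (drop i u))"
    if "f \<in> carrier F" "g \<in> carrier F" for f g u
  proof -
    let ?A = "{w. f w \<noteq> 0}" and ?B = "{w. g w \<noteq> 0}"
    have fin: "finite ?A" "finite ?B" "?A \<subseteq> lists {1..n}" "?B \<subseteq> lists {1..n}"
      using that by (auto simp: carr)
    show ?thesis
      unfolding F_def free_alg_def malg_mult[OF fin(1,2) subset_refl subset_refl fin(3,4)]
      by (rule sum_splittings[symmetric]) (use fin in auto)
  qed
  have smult: "malg_smult c f \<in> carrier F" if "f \<in> carrier F" for c f
  proof -
    have "finite {w. c * f w \<noteq> 0}"
      using that by (auto simp: carr intro: finite_subset[of _ "{w. f w \<noteq> 0}"])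
    then show ?thesis using that by (auto simp: carr malg_smult_def)
  qed
  have hom: "restrict_to L \<in> ring_hom F (lang_alg L)"
  proof (rule ring_hom_memI)
    fix f g assume f: "f \<in> carrier F" and g: "g \<in> carrier F"
    show "restrict_to L f \<in> carrier (lang_alg L)"
      using f by (auto simp: carr lang_alg_simps restrict_to_def
          intro: finite_subset[of _ "{w. f w \<noteq> 0}"] split: if_splits)
    show "restrict_to L (f \<oplus>\<^bsub>F\<^esub> g) = restrict_to L f \<oplus>\<^bsub>lang_alg L\<^esub> restrict_to L g"
      by (auto simp: restrict_to_def add lang_alg_simps)
    show "restrict_to L (f \<otimes>\<^bsub>F\<^esub> g) = restrict_to L f \<otimes>\<^bsub>lang_alg L\<^esub> restrict_to L g"
    proof
      fix u
      have "take i u \<in> L \<and> drop i u \<in> L" if "u \<in> L" for i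
        using that prefix_mem[of "take i u" "drop i u"] suffix_mem[of "take i u" "drop i u"] by simp
      then show "restrict_to L (f \<otimes>\<^bsub>F\<^esub> g) u = (restrict_to L f \<otimes>\<^bsub>lang_alg L\<^esub> restrict_to L g) u"
        by (simp add: restrict_to_def lang_alg_simps mult[OF f g])
    qed
  next
    show "restrict_to L \<one>\<^bsub>F\<^esub> = \<one>\<^bsub>lang_alg L\<^esub>"
      using Nil_mem by (auto simp: restrict_to_def one lang_alg_simps)
  qed
  have surj: "restrict_to L ` carrier F = carrier (lang_alg L)"
  proof
    show "restrict_to L ` carrier F \<subseteq> carrier (lang_alg L)" using ring_hom_closed[OF hom] by blast
    show "carrier (lang_alg L) \<subseteq> restrict_to L ` carrier F"
    proof
      fix f :: "nat list \<Rightarrow> 'k" assume f: "f \<in> carrier (lang_alg L)"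
      then have "f = restrict_to L f" by (auto simp: restrict_to_def lang_alg_simps fun_eq_iff)
      moreover have "f \<in> carrier F" using f L by (auto simp: carr lang_alg_simps)
      ultimately show "f \<in> restrict_to L ` carrier F" by blast
    qed
  qed
  have "restrict_to L \<zero>\<^bsub>F\<^esub> = (\<lambda>w. 0)" by (auto simp: restrict_to_def zero)
  then show ringL: "ring (lang_alg L :: (nat list \<Rightarrow> 'k) ring)"
    by (rule ring_lang_alg_if_image[OF F.ring_axioms hom surj])
  let ?K = "{f \<in> carrier F. restrict_to L f = \<zero>\<^bsub>lang_alg L\<^esub>}"
  have "ring_hom_ring F (lang_alg L) (restrict_to L)"
    using F.ring_axioms ringL hom by (rule ring_hom_ringI2)
  then interpret hom: ring_hom_ring F "lang_alg L" "restrict_to L" .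
  have "ideal ?K F" using hom.kernel_is_ideal unfolding a_kernel_def' .
  moreover have "word_elem ` (lists {1..n} - L) \<subseteq> ?K"
    by (auto simp: word_elem_def carr restrict_to_def lang_alg_simps fun_eq_iff split: if_splits)
  ultimately have "I \<subseteq> ?K" unfolding I_def by (rule F.genideal_minimal)
  moreover have "?K \<subseteq> I"
  proof
    have W: "word_elem ` (lists {1..n} - L) \<subseteq> carrier F"
      by (auto simp: word_elem_def carr split: if_splits)
    interpret I: ideal I F unfolding I_def using W by (rule F.genideal_ideal)
    \<comment> \<open>The ideal is closed under scalars because \<open>c\<close> is realized in the
      ring as \<open>c\<close> times the empty word.\<close>
    have Iw: "(\<lambda>v. if v = w then c else 0) \<in> I" if "w \<in> lists {1..n} - L" for c w
    proof -
      let ?c = "\<lambda>v :: nat list. if v = [] then c else 0"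
      have c: "?c \<in> carrier F" by (auto simp: carr)
      have w: "word_elem w \<in> I" using F.genideal_self[OF W] that unfolding I_def by blast
      then have wF: "word_elem w \<in> carrier F" using I.a_subset by blast
      have "?c \<otimes>\<^bsub>F\<^esub> word_elem w = (\<lambda>v. if v = w then c else 0)"
      proof
        fix u
        have "(\<Sum>i\<le>length u. ?c (take i u) * word_elem w (drop i u))
            = (\<Sum>i\<le>length u. if i = 0 then c * word_elem w u else 0)"
          by (intro sum.cong) (auto simp: word_elem_def)
        also have "\<dots> = c * word_elem w u" by simp
        finally show "(?c \<otimes>\<^bsub>F\<^esub> word_elem w) u = (if u = w then c else 0)"
          unfolding mult[OF c wF] by (simp add: word_elem_def)
      qed
      then show ?thesis using I.I_l_closed[OF w c] by simp
    qed
    fix f assume f: "f \<in> ?K"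
    \<comment> \<open>Induction on the support splits off one forbidden word at a time.\<close>
    have "g \<in> I" if "finite S" "{w. g w \<noteq> 0} = S" "S \<subseteq> lists {1..n} - L" for S and g :: "nat list \<Rightarrow> 'k"
      using that
    proof (induction S arbitrary: g rule: finite_induct)
      case empty
      then have "g = \<zero>\<^bsub>F\<^esub>" by (auto simp: zero)
      then show ?case using I.zero_closed by simp
    next
      case (insert w S)
      let ?g = "g(w := 0)"
      have "{v. ?g v \<noteq> 0} = S" using insert.prems(1) insert.hyps(2) by auto
      then have "?g \<in> I" using insert by blast
      moreover have "(\<lambda>v. if v = w then g w else 0) \<in> I" using Iw insert.prems by blast
      ultimately have "?g \<oplus>\<^bsub>F\<^esub> (\<lambda>v. if v = w then g w else 0) \<in> I" by (rule I.a_closed)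
      moreover have "?g \<oplus>\<^bsub>F\<^esub> (\<lambda>v. if v = w then g w else 0) = g" by (auto simp: add)
      ultimately show ?case by simp
    qed
    moreover have "f w = 0" if "w \<in> L" for w
    proof -
      have "restrict_to L f w = 0" using f by (simp add: lang_alg_simps)
      then show ?thesis using that by (simp add: restrict_to_def)
    qed
    then have "finite {w. f w \<noteq> 0}" "{w. f w \<noteq> 0} \<subseteq> lists {1..n} - L"
      using f by (auto simp: carr)
    ultimately show "f \<in> I" by blast
  qed
  ultimately have I: "I = ?K" by blast
  have sm: "malg_smult c x \<in> carrier F \<and> restrict_to L (malg_smult c x) = malg_smult c (restrict_to L x)"
    if "x \<in> carrier F" for c x
    using smult[OF that] by (auto simp: restrict_to_def malg_smult_def)
  note q = quotient_kalg_iso[OF F.ring_axioms ringL hom surj I, of malg_smult malg_smult, OF sm]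
  show "ring (F Quot I)" by (rule q(1))
  show "kalg_iso (F Quot I) (quot_smult F I malg_smult) (lang_alg L) malg_smult
      (\<lambda>X. the_elem (restrict_to L ` X))" by (rule q(2))
  show "X \<in> carrier (F Quot I) \<Longrightarrow> quot_smult F I malg_smult c X \<in> carrier (F Quot I)" by (rule q(3))
qed

section \<open>Periodic languages and the standard identity\<close>

definition matches :: "(nat \<Rightarrow> 'a) \<Rightarrow> nat \<Rightarrow> 'a list \<Rightarrow> bool" where
  "matches f t w \<longleftrightarrow> (\<forall>k<length w. w ! k = f (t + k))"

lemma matches_append: "matches f t (v @ w) \<longleftrightarrow> matches f t v \<and> matches f (t + length v) w"
proof
  assume *: "matches f t (v @ w)"
  have "v ! k = f (t + k)" if "k < length v" for k
    using * that unfolding matches_def by (metis length_append nth_append trans_less_add1)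
  moreover have "w ! k = f (t + length v + k)" if "k < length w" for k
    using *[unfolded matches_def, rule_format, of "length v + k"] that by (simp add: add.assoc)
  ultimately show "matches f t v \<and> matches f (t + length v) w" unfolding matches_def by blast
next
  assume *: "matches f t v \<and> matches f (t + length v) w"
  show "matches f t (v @ w)" unfolding matches_def
  proof (intro allI impI)
    fix k assume "k < length (v @ w)"
    then show "(v @ w) ! k = f (t + k)"
      using * unfolding matches_def by (cases "k < length v") (auto simp: nth_append)
  qed
qed

text \<open>Replaces equality with \<open>u\<close> by two conditions that can each be tracked when
  words of equal type are exchanged.\<close>

lemma eq_iff_matches:
  assumes "\<forall>k<length u. u ! k = f k"
  shows "w = u \<longleftrightarrow> length w = length u \<and> matches f 0 w"
  using assms by (auto simp: matches_def list_eq_iff_nth_eq)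

text \<open>Words of the same type can replace each other in any factorization of a D-periodic word.\<close>

definition word_type :: "nat \<Rightarrow> (nat \<Rightarrow> 'a) \<Rightarrow> 'a list \<Rightarrow> nat \<times> nat set" where
  "word_type D f w = (length w mod D, {t. t < D \<and> matches f t w})"

lemma matches_mod:
  assumes "\<forall>k. f (k mod D) = f k"
  shows "matches f (t mod D) w \<longleftrightarrow> matches f t w"
proof -
  have "f (t mod D + k) = f (t + k)" for k
    using assms[rule_format, of "t mod D + k"] assms[rule_format, of "t + k"] by (simp add: mod_add_left_eq)
  then show ?thesis by (simp add: matches_def)
qed

lemma matches_word_type:
  assumes f: "\<forall>k. f (k mod D) = f k" and "0 < D" "word_type D f v = word_type D f w" "s mod D = t mod D"
  shows "matches f s v \<longleftrightarrow> matches f t w"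
proof -
  have "{t. t < D \<and> matches f t v} = {t. t < D \<and> matches f t w}"
    using assms(3) by (simp add: word_type_def)
  then have "t mod D \<in> {t. t < D \<and> matches f t v} \<longleftrightarrow> t mod D \<in> {t. t < D \<and> matches f t w}"
    by (rule arg_cong)
  then have "matches f (t mod D) v \<longleftrightarrow> matches f (t mod D) w" using \<open>0 < D\<close> by simp
  then show ?thesis
    using matches_mod[OF f, of s v] matches_mod[OF f, of t v] matches_mod[OF f, of t w] assms(4) by simp
qed

text \<open>Equal types have equal lengths modulo \<open>D\<close>, so corresponding factors start
  at congruent positions throughout.\<close>

lemma matches_concat:
  assumes f: "\<forall>k. f (k mod D) = f k" and D: "0 < D"
    and "list_all2 (\<lambda>v w. word_type D f v = word_type D f w) vs ws" "s mod D = t mod D"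
  shows "matches f s (concat vs) \<longleftrightarrow> matches f t (concat ws)"
  using assms(3,4)
proof (induction vs ws arbitrary: s t rule: list_all2_induct)
  case Nil
  show ?case by (simp add: matches_def)
next
  case (Cons v vs w ws)
  have "length v mod D = length w mod D" using Cons.hyps(1) by (simp add: word_type_def)
  then have "(s + length v) mod D = (t + length w) mod D" using Cons.prems by (metis mod_add_cong)
  then show ?case
    using Cons.IH matches_word_type[OF f D Cons.hyps(1) Cons.prems]
    by (simp add: matches_append)
qed

text \<open>Types record lengths only modulo \<open>D\<close>, so the exact total length must come
  from invariance under permutation of the factors.\<close>

lemma length_concat_permuted:
  assumes "\<sigma> permutes {1..m}"
  shows "length (concat (map v (map \<sigma> [1..<Suc m]))) = (\<Sum>i\<in>{1..m}. length (v i))"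
proof -
  have "length (concat (map v (map \<sigma> [1..<Suc m]))) = sum_list (map (\<lambda>i. length (v (\<sigma> i))) [1..<Suc m])"
    by (simp add: length_concat comp_def)
  also have "\<dots> = (\<Sum>i\<in>set [1..<Suc m]. length (v (\<sigma> i)))"
    by (rule sum_list_distinct_conv_sum_set) (rule distinct_upt)
  also have "\<dots> = (\<Sum>i\<in>{1..m}. length (v (\<sigma> i)))" by (intro sum.cong) auto
  also have "\<dots> = (\<Sum>i\<in>{1..m}. length (v i))"
    using sum.permute[OF assms, of "\<lambda>i. length (v i)"] by (simp add: comp_def)
  finally show ?thesis .
qed

text \<open>Pigeonhole yields two words of the same type, and exchanging them is a sign-reversing involution
  on the factorizations.\<close>

lemma signed_factorizations_cancel:
  fixes v :: "nat \<Rightarrow> 'a list"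
  assumes u: "has_period D u" and D: "0 < D" and m: "D * 2 ^ D < m"
  shows "(\<Sum>\<sigma> | \<sigma> permutes {1..m}. if concat (map v (map \<sigma> [1..<Suc m])) = u then sign \<sigma> else 0) = 0"
    (is "?S = 0")
proof -
  define f where "f k = u ! (k mod D)" for k
  have f: "\<forall>k. f (k mod D) = f k" by (simp add: f_def)
  have uf: "\<forall>k<length u. u ! k = f k" using has_period_mod[OF u] by (simp add: f_def)
  \<comment> \<open>There are at most \<open>D * 2 ^ D\<close> types: a residue of the length and a
    set of positions below \<open>D\<close>.\<close>
  have "(word_type D f \<circ> v) ` {1..m} \<subseteq> {..<D} \<times> Pow {..<D}"
    using D by (auto simp: word_type_def)
  then have "card ((word_type D f \<circ> v) ` {1..m}) \<le> card ({..<D} \<times> Pow {..<D})"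
    by (intro card_mono) auto
  also have "\<dots> < card {1..m}" using m by (simp add: card_Pow card_cartesian_product)
  finally have "\<not> inj_on (word_type D f \<circ> v) {1..m}" by (rule pigeonhole)
  then obtain i j where ij: "i \<in> {1..m}" "j \<in> {1..m}" "i \<noteq> j" "word_type D f (v i) = word_type D f (v j)"
    by (auto simp: inj_on_def)
  define \<rho> where "\<rho> = transpose i j"
  have \<rho>: "\<rho> permutes {1..m}" unfolding \<rho>_def using ij by (intro permutes_swap_id)
  have type: "word_type D f (v (\<rho> k)) = word_type D f (v k)" for k
    using ij(4) by (simp add: \<rho>_def transpose_def)
  have inv: "concat (map v (map (\<rho> \<circ> \<sigma>) [1..<Suc m])) = u \<longleftrightarrow> concat (map v (map \<sigma> [1..<Suc m])) = u"
    if "\<sigma> permutes {1..m}" for \<sigma>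
  proof -
    have "list_all2 (\<lambda>v w. word_type D f v = word_type D f w)
        (map v (map (\<rho> \<circ> \<sigma>) [1..<Suc m])) (map v (map \<sigma> [1..<Suc m]))"
      using type by (simp add: list_all2_conv_all_nth)
    then have "matches f 0 (concat (map v (map (\<rho> \<circ> \<sigma>) [1..<Suc m])))
        \<longleftrightarrow> matches f 0 (concat (map v (map \<sigma> [1..<Suc m])))"
      by (rule matches_concat[OF f D _ refl])
    moreover have "length (concat (map v (map (\<rho> \<circ> \<sigma>) [1..<Suc m])))
        = length (concat (map v (map \<sigma> [1..<Suc m])))"
      unfolding length_concat_permuted[OF that] length_concat_permuted[OF permutes_compose[OF that \<rho>]] ..
    ultimately show ?thesis unfolding eq_iff_matches[OF uf] by (simp only:)
  qed
  have "?S = (\<Sum>\<sigma> | \<sigma> permutes {1..m}.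
      if concat (map v (map (\<rho> \<circ> \<sigma>) [1..<Suc m])) = u then sign (\<rho> \<circ> \<sigma>) else 0)"
    by (rule setum_permutations_compose_left[OF \<rho>])
  also have "\<dots> = (\<Sum>\<sigma> | \<sigma> permutes {1..m}. - (if concat (map v (map \<sigma> [1..<Suc m])) = u then sign \<sigma> else 0))"
  proof (rule sum.cong[OF refl])
    fix \<sigma> assume "\<sigma> \<in> {\<sigma>. \<sigma> permutes {1..m}}"
    then have \<sigma>: "\<sigma> permutes {1..m}" by simp
    have "permutation \<rho>" "permutation \<sigma>"
      using \<rho> \<sigma> permutes_imp_permutation finite_atLeastAtMost by blast+
    then have "sign (\<rho> \<circ> \<sigma>) = - sign \<sigma>"
      using ij(3) by (simp add: sign_compose \<rho>_def sign_swap_id)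
    then show "(if concat (map v (map (\<rho> \<circ> \<sigma>) [1..<Suc m])) = u then sign (\<rho> \<circ> \<sigma>) else 0) =
        - (if concat (map v (map \<sigma> [1..<Suc m])) = u then sign \<sigma> else 0)"
      unfolding inv[OF \<sigma>] by simp
  qed
  \<comment> \<open>The signs are integers, so a sum equal to its negative is 0; this covers fields
    of characteristic 2 as well.\<close>
  also have "\<dots> = - ?S" by (rule sum_negf)
  finally show ?thesis by simp
qed

section \<open>The standard polynomial and its vanishing\<close>

lemma sum_PiE_insert:
  assumes "i \<notin> I" 
  shows "(\<Sum>g\<in>PiE (insert i I) (\<lambda>_. X). F g) = (\<Sum>x\<in>X. \<Sum>g\<in>PiE I (\<lambda>_. X). F (g(i := x)))"
proof -
  have "(\<Sum>g\<in>PiE (insert i I) (\<lambda>_. X). F g) = (\<Sum>(x, g)\<in>X \<times> PiE I (\<lambda>_. X). F (g(i := x)))"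
    unfolding PiE_insert_eq using inj_combinator[OF assms, of "\<lambda>_. X"]
    by (subst sum.reindex) (auto simp: case_prod_unfold)
  then show ?thesis by (simp add: sum.cartesian_product)
qed

definition standard_poly :: "nat \<Rightarrow> nat list \<Rightarrow> 'k::field" where
  "standard_poly m w = (\<Sum>\<sigma> | \<sigma> permutes {1..m}. if w = map \<sigma> [1..<Suc m] then of_int (sign \<sigma>) else 0)"

lemma permutes_eqI_list:
  assumes "\<sigma> permutes {1..m}" "\<tau> permutes {1..m}" "map \<sigma> [1..<Suc m] = map \<tau> [1..<Suc m]"
  shows "\<sigma> = \<tau>"
proof
  fix k
  show "\<sigma> k = \<tau> k"
  proof (cases "k \<in> {1..m}")
    case True
    then have "k \<in> set [1..<Suc m]" by auto
    then show ?thesis using assms(3) by (metis map_eq_conv)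
  next
    case False
    then show ?thesis using permutes_not_in[OF assms(1)] permutes_not_in[OF assms(2)] by simp
  qed
qed

lemma standard_poly_perm:
  assumes "\<sigma> permutes {1..m}"
  shows "standard_poly m (map \<sigma> [1..<Suc m]) = of_int (sign \<sigma>)"
proof -
  have "standard_poly m (map \<sigma> [1..<Suc m])
      = (\<Sum>\<tau> | \<tau> permutes {1..m}. if \<tau> = \<sigma> then of_int (sign \<sigma>) else (0::'a))"
    unfolding standard_poly_def using permutes_eqI_list[OF assms]
    by (intro sum.cong) (auto split: if_splits)
  then show ?thesis using assms finite_permutations[of "{1..m}"] by simp
qed

lemma standard_poly_support:
  "{w. (standard_poly m w :: 'k::field) \<noteq> 0} = (\<lambda>\<sigma>. map \<sigma> [1..<Suc m]) ` {\<sigma>. \<sigma> permutes {1..m}}"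
proof
  show "{w. (standard_poly m w :: 'k) \<noteq> 0} \<subseteq> (\<lambda>\<sigma>. map \<sigma> [1..<Suc m]) ` {\<sigma>. \<sigma> permutes {1..m}}"
    unfolding standard_poly_def by (auto elim!: sum.not_neutral_contains_not_neutral split: if_splits)
  show "(\<lambda>\<sigma>. map \<sigma> [1..<Suc m]) ` {\<sigma>. \<sigma> permutes {1..m}} \<subseteq> {w. (standard_poly m w :: 'k) \<noteq> 0}"
  proof (intro image_subsetI CollectI)
    fix \<sigma> assume "\<sigma> \<in> {\<sigma>. \<sigma> permutes {1..m}}"
    then have "(standard_poly m (map \<sigma> [1..<Suc m]) :: 'k) = of_int (sign \<sigma>)"
      using standard_poly_perm by blast
    then show "(standard_poly m (map \<sigma> [1..<Suc m]) :: 'k) \<noteq> 0"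
      by (cases \<sigma> rule: sign_cases) (simp_all del: upt_Suc)
  qed
qed

context monomial_alg
begin

lemma foldr_closed:
  "(\<And>i. i \<in> set is \<Longrightarrow> a i \<in> carrier A) \<Longrightarrow> foldr (\<lambda>x y. x \<otimes> y) (map a is) \<one> \<in> carrier A"
  by (induction "is") auto

text \<open>Expands a long product over all factorizations of \<open>u\<close>. Distinct indices
  allow a factorization to be stored as a function on the index set, and the finite factor-closed
  \<open>X\<close> bounds the possible factors.\<close>

lemma coeff_product:
  assumes X: "finite X" "\<forall>x z. x @ z \<in> X \<longrightarrow> x \<in> X \<and> z \<in> X"
    and "distinct is" "\<forall>i\<in>set is. a i \<in> carrier A" "u \<in> L" "u \<in> X"
  shows "coeff (foldr (\<lambda>x y. x \<otimes> y) (map a is) \<one>) u =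
    (\<Sum>v\<in>PiE (set is) (\<lambda>_. X). if concat (map v is) = u then \<Prod>i\<in>set is. coeff (a i) (v i) else 0)"
  using assms(3-)
proof (induction "is" arbitrary: u)
  case Nil
  then show ?case by (simp add: coeff_one)
next
  case (Cons i "is")
  let ?R = "foldr (\<lambda>x y. x \<otimes> y) (map a is) \<one>" and ?V = "PiE (set is) (\<lambda>_. X)"
  have R: "?R \<in> carrier A" using Cons.prems by (intro foldr_closed) auto
  have i: "i \<notin> set is" "a i \<in> carrier A" using Cons.prems by auto
  have V: "finite ?V" using X(1) by (intro finite_PiE) auto
  have split: "x \<in> X \<and> z \<in> X \<and> z \<in> L" if "x @ z = u" for x z
    using that X(2) Cons.prems(3,4) suffix_mem by blast
  have "coeff (a i \<otimes> ?R) u = (\<Sum>x\<in>X. \<Sum>z\<in>X. if x @ z = u then coeff (a i) x * coeff ?R z else 0)"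
    using Cons.prems(3) i R split X(1) sum_splittings[of X X u "\<lambda>x z. coeff (a i) x * coeff ?R z"]
    by (simp add: coeff_mult)
  also have "\<dots> = (\<Sum>x\<in>X. \<Sum>z\<in>X. \<Sum>v\<in>?V. if concat (map v is) = z
      then if x @ concat (map v is) = u then coeff (a i) x * (\<Prod>i\<in>set is. coeff (a i) (v i)) else 0 else 0)"
  proof (intro sum.cong refl)
    fix x z
    show "(if x @ z = u then coeff (a i) x * coeff ?R z else 0) = (\<Sum>v\<in>?V. if concat (map v is) = z
      then if x @ concat (map v is) = u then coeff (a i) x * (\<Prod>i\<in>set is. coeff (a i) (v i)) else 0 else 0)"
    proof (cases "x @ z = u")
      case True
      then have "coeff ?R z = (\<Sum>v\<in>?V. if concat (map v is) = z then \<Prod>i\<in>set is. coeff (a i) (v i) else 0)"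
        using Cons.IH Cons.prems split by auto
      then show ?thesis using True by (auto simp: sum_distrib_left intro!: sum.cong)
    next
      case False
      then show ?thesis by (subst sum.neutral) auto
    qed
  qed
  also have "\<dots> = (\<Sum>x\<in>X. \<Sum>v\<in>?V. \<Sum>z\<in>X. if concat (map v is) = z
      then if x @ concat (map v is) = u then coeff (a i) x * (\<Prod>i\<in>set is. coeff (a i) (v i)) else 0 else 0)"
    by (rule sum.cong[OF refl], rule sum.swap)
  also have "\<dots> = (\<Sum>x\<in>X. \<Sum>v\<in>?V. if x @ concat (map v is) = u
      then coeff (a i) x * (\<Prod>i\<in>set is. coeff (a i) (v i)) else 0)"
    using split by (intro sum.cong refl, subst sum.delta'[OF X(1)]) auto
  also have "\<dots> = (\<Sum>x\<in>X. \<Sum>v\<in>?V. if concat (map (v(i := x)) (i # is)) = u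
      then \<Prod>j\<in>set (i # is). coeff (a j) ((v(i := x)) j) else 0)"
  proof (intro sum.cong refl)
    fix x :: "nat list" and v :: "_ \<Rightarrow> nat list"
    have "map (v(i := x)) is = map v is" using i(1) by auto
    moreover have "(\<Prod>j\<in>set is. coeff (a j) ((v(i := x)) j)) = (\<Prod>j\<in>set is. coeff (a j) (v j))"
      using i(1) by (intro prod.cong) auto
    ultimately show "(if x @ concat (map v is) = u
      then coeff (a i) x * (\<Prod>i\<in>set is. coeff (a i) (v i)) else 0) =
      (if concat (map (v(i := x)) (i # is)) = u then \<Prod>j\<in>set (i # is). coeff (a j) ((v(i := x)) j) else 0)"
      using i(1) by simp
  qed
  also have "\<dots> = (\<Sum>v\<in>PiE (set (i # is)) (\<lambda>_. X).
      if concat (map v (i # is)) = u then \<Prod>j\<in>set (i # is). coeff (a j) (v j) else 0)"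
    by (simp only: list.set(2) sum_PiE_insert[OF i(1)])
  finally show ?case by simp
qed

text \<open>Each coefficient of the evaluated standard polynomial is a combination of the signed
  counts in \<open>signed_factorizations_cancel\<close>.\<close>

theorem periodic_PI:
  assumes D: "0 < D" "\<And>u. u \<in> L \<Longrightarrow> has_period D u"
  shows "PI_algebra A sm"
proof -
  \<comment> \<open>One more than the number of possible types, as the pigeonhole argument
    requires.\<close>
  define m where "m = D * 2 ^ D + 1"
  let ?is = "[1..<Suc m]" and ?P = "{\<sigma>. \<sigma> permutes {1..m}}"
  let ?f = "standard_poly m :: nat list \<Rightarrow> 'k"
  have fin: "finite ?P" by (rule finite_permutations) simp
  have set_is: "set (map \<sigma> ?is) = {1..m}" if "\<sigma> permutes {1..m}" for \<sigma>
  proof -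
    have "set (map \<sigma> ?is) = \<sigma> ` {1..m}" by auto
    then show ?thesis using permutes_image[OF that] by simp
  qed
  have "?f \<in> carrier (free_alg m)"
    unfolding free_alg_def malg_simps
  proof (intro CollectI conjI allI impI)
    show "finite {w. ?f w \<noteq> 0}" unfolding standard_poly_support using fin by (rule finite_imageI)
    fix w assume "?f w \<noteq> 0"
    then have "w \<in> (\<lambda>\<sigma>. map \<sigma> ?is) ` ?P" using standard_poly_support by blast
    then obtain \<sigma> where "\<sigma> permutes {1..m}" "w = map \<sigma> ?is" by blast
    then show "w \<in> lists {1..m}" using set_is by (auto simp only: lists_eq_set)
  qed
  moreover have "?f \<noteq> (\<lambda>_. 0)"
  proof
    assume *: "?f = (\<lambda>_. 0)"
    have "map id ?is \<in> {w. ?f w \<noteq> 0}" unfolding standard_poly_support using permutes_id by blast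
    then show False unfolding * by simp
  qed
  moreover have "ncpoly_eval A sm ?f a = \<zero>" if a: "\<forall>i\<in>{1..m}. a i \<in> carrier A" for a
  proof (rule coeff_eqI)
    let ?g = "\<lambda>w. foldr (\<lambda>x y. x \<otimes> y) (map a w) \<one>"
    have g: "?g w \<in> carrier A" if w: "w \<in> {w. ?f w \<noteq> 0}" for w
    proof -
      obtain \<sigma> where "\<sigma> permutes {1..m}" "w = map \<sigma> ?is"
        using w unfolding standard_poly_support by blast
      then have "set w = {1..m}" using set_is by simp
      then show ?thesis using a by (intro foldr_closed) blast
    qed
    have finf: "finite {w. ?f w \<noteq> 0}" unfolding standard_poly_support using fin by (rule finite_imageI)
    show "ncpoly_eval A sm ?f a \<in> carrier A"
      unfolding ncpoly_eval_def using g sm_closed by (intro finsum_closed) auto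
    fix u
    show "coeff (ncpoly_eval A sm ?f a) u = coeff \<zero> u"
    proof (cases "u \<in> L")
      case False
      then show ?thesis using \<open>ncpoly_eval A sm ?f a \<in> carrier A\<close> coeff_mem coeff_zero by metis
    next
      case True
      \<comment> \<open>The factors of \<open>u\<close> are the only words that can occur in a
        factorization of \<open>u\<close>.\<close>
      let ?X = "{x. \<exists>p q. u = p @ x @ q}"
      have "?X \<subseteq> set (sublists u)" by auto
      then have X: "finite ?X" by (rule finite_subset) simp
      have X_factor: "\<forall>x z. x @ z \<in> ?X \<longrightarrow> x \<in> ?X \<and> z \<in> ?X"
      proof (intro allI impI)
        fix x z assume "x @ z \<in> ?X"
        then obtain p q where "u = p @ (x @ z) @ q" by blast
        then have "u = p @ x @ (z @ q)" "u = (p @ x) @ z @ q" by simp_all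
        then show "x \<in> ?X \<and> z \<in> ?X" by blast
      qed
      have uX: "u \<in> ?X" by (intro CollectI exI[of _ "[]"]) simp
      let ?V = "PiE {1..m} (\<lambda>_. ?X)" and ?c = "\<lambda>v. \<Prod>i\<in>{1..m}. coeff (a i) (v i)"
      let ?eq = "\<lambda>v \<sigma>. concat (map v (map \<sigma> ?is)) = u"
      have prod: "coeff (?g (map \<sigma> ?is)) u = (\<Sum>v\<in>?V. if ?eq v \<sigma> then ?c v else 0)"
        if \<sigma>: "\<sigma> permutes {1..m}" for \<sigma>
      proof -
        have "distinct (map \<sigma> ?is)"
          using permutes_inj_on[OF \<sigma>] by (simp add: distinct_map del: upt_Suc)
        moreover have "\<forall>i\<in>set (map \<sigma> ?is). a i \<in> carrier A" using a unfolding set_is[OF \<sigma>] .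
        ultimately show ?thesis
          using coeff_product[OF X X_factor _ _ True uX] unfolding set_is[OF \<sigma>, symmetric] by blast
      qed
      have "coeff (ncpoly_eval A sm ?f a) u = (\<Sum>w | ?f w \<noteq> 0. ?f w * coeff (?g w) u)"
        unfolding ncpoly_eval_def using finf g sm_closed by (subst coeff_finsum) (auto simp: coeff_sm)
      also have "\<dots> = (\<Sum>\<sigma>\<in>?P. ?f (map \<sigma> ?is) * coeff (?g (map \<sigma> ?is)) u)"
        unfolding standard_poly_support using permutes_eqI_list
        by (intro sum.reindex_cong[OF _ refl refl]) (auto simp: inj_on_def simp del: upt_Suc)
      also have "\<dots> = (\<Sum>\<sigma>\<in>?P. \<Sum>v\<in>?V. of_int (if ?eq v \<sigma> then sign \<sigma> else 0) * ?c v)"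
      proof (rule sum.cong[OF refl])
        fix \<sigma> assume "\<sigma> \<in> ?P"
        then have \<sigma>: "\<sigma> permutes {1..m}" by simp
        show "?f (map \<sigma> ?is) * coeff (?g (map \<sigma> ?is)) u
            = (\<Sum>v\<in>?V. of_int (if ?eq v \<sigma> then sign \<sigma> else 0) * ?c v)"
          unfolding standard_poly_perm[OF \<sigma>] prod[OF \<sigma>] sum_distrib_left
          by (intro sum.cong refl) (simp del: upt_Suc map_map)
      qed
      \<comment> \<open>For a fixed choice \<open>v\<close> of words the coefficient product does
        not depend on the permutation, so the signs can be summed first.\<close>
      also have "\<dots> = (\<Sum>v\<in>?V. \<Sum>\<sigma>\<in>?P. of_int (if ?eq v \<sigma> then sign \<sigma> else 0) * ?c v)"
        by (rule sum.swap)
      also have "\<dots> = (\<Sum>v\<in>?V. of_int (\<Sum>\<sigma>\<in>?P. if ?eq v \<sigma> then sign \<sigma> else 0) * ?c v)"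
        by (simp only: of_int_sum sum_distrib_right)
      also have "\<dots> = 0"
        using signed_factorizations_cancel[OF D(2)[OF True] D(1), of m] by (simp add: m_def)
      finally show ?thesis by (simp add: coeff_zero)
    qed
  qed simp
  ultimately show ?thesis unfolding PI_algebra_def by blast
qed

end

section \<open>The monoids S_n(H)\<close>

lemma Scong_refl: "Scong n H w w"
  by (simp add: Scong_def)

lemma Scong_trans: "Scong n H u v \<Longrightarrow> Scong n H v w \<Longrightarrow> Scong n H u w"
  by (simp add: Scong_def)

lemma Scong_sym: "Scong n H u v \<Longrightarrow> Scong n H v u"
  unfolding Scong_def
proof (induction rule: rtranclp_induct)
  case (step y z)
  from step.hyps(2) have "symclp (Sstep n H) z y" by (auto simp: symclp_def)
  then show ?case using step.IH by (rule converse_rtranclp_into_rtranclp)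
qed simp

lemma Sstep_context: "Sstep n H v w \<Longrightarrow> Sstep n H (x @ v @ y) (x @ w @ y)"
  unfolding Sstep_def by (metis append.assoc)

lemma Scong_context: "Scong n H v w \<Longrightarrow> Scong n H (x @ v @ y) (x @ w @ y)"
  unfolding Scong_def
proof (induction rule: rtranclp_induct)
  case (step v w)
  from step.hyps(2) have "symclp (Sstep n H) (x @ v @ y) (x @ w @ y)"
    by (auto elim!: symclpE intro: symclpI1 symclpI2 Sstep_context)
  with step.IH show ?case by (rule rtranclp.rtrancl_into_rtrancl)
qed simp

lemma Scong_append: "Scong n H v v' \<Longrightarrow> Scong n H w w' \<Longrightarrow> Scong n H (v @ w) (v' @ w')"
  using Scong_context[of n H v v' "[]" w] Scong_context[of n H w w' v' "[]"] Scong_trans by simp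

lemma mem_Scls: "w \<in> Scls n H w"
  by (simp add: Scls_def Scong_refl)

lemma Scls_eq_iff: "Scls n H v = Scls n H w \<longleftrightarrow> Scong n H v w"
proof
  assume eq: "Scls n H v = Scls n H w"
  have "w \<in> Scls n H v" unfolding eq by (rule mem_Scls)
  then show "Scong n H v w" by (simp add: Scls_def)
next
  assume vw: "Scong n H v w"
  show "Scls n H v = Scls n H w"
    unfolding Scls_def using Scong_trans[OF vw] Scong_trans[OF Scong_sym[OF vw]] by (intro Collect_cong iffI)
qed

lemma Smult_Scls: "Smult n H (Scls n H v) (Scls n H w) = Scls n H (v @ w)"
proof
  show "Smult n H (Scls n H v) (Scls n H w) \<subseteq> Scls n H (v @ w)"
  proof
    fix x assume "x \<in> Smult n H (Scls n H v) (Scls n H w)"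
    then obtain v' w' where "Scong n H v v'" "Scong n H w w'" "Scong n H (v' @ w') x"
      by (auto simp: Smult_def Scls_def)
    then have "Scong n H (v @ w) x" using Scong_append Scong_trans by blast
    then show "x \<in> Scls n H (v @ w)" by (simp add: Scls_def)
  qed
  show "Scls n H (v @ w) \<subseteq> Smult n H (Scls n H v) (Scls n H w)"
    using mem_Scls by (fastforce simp: Smult_def Scls_def[of n H "v @ w"])
qed

lemma SmonE:
  assumes "X \<in> Smon n H" obtains w where "w \<in> lists {1..n}" "X = Scls n H w"
  using assms by (auto simp: Smon_def)

lemma Scls_Smon: "w \<in> lists {1..n} \<Longrightarrow> Scls n H w \<in> Smon n H"
  by (simp add: Smon_def)

lemma Smon_mult_closed:
  assumes "X \<in> Smon n H" "Y \<in> Smon n H" shows "Smult n H X Y \<in> Smon n H"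
proof -
  obtain v w where "v \<in> lists {1..n}" "X = Scls n H v" "w \<in> lists {1..n}" "Y = Scls n H w"
    using assms by (elim SmonE)
  then show ?thesis using Scls_Smon[of "v @ w" n H] by (simp add: Smult_Scls)
qed

lemma ring_Smon_alg: "ring (malg (Smon n H) (Smult n H) (Sone n H) :: (nat list set \<Rightarrow> 'k::field) ring)"
proof (rule malg_ring)
  show "Smult n H X Y \<in> Smon n H" if "X \<in> Smon n H" "Y \<in> Smon n H" for X Y
    using that by (rule Smon_mult_closed)
  show "Sone n H \<in> Smon n H" unfolding Sone_def by (rule Scls_Smon) simp
qed (auto elim!: SmonE simp: Smult_Scls Sone_def)

text \<open>A forbidden factor no longer than the overlap \<open>s\<close> cannot reach from inside
  \<open>u\<close> into \<open>v\<close>, so it already lies in \<open>u @ s\<close> or in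
  \<open>s @ v\<close>.\<close>

lemma finite_type_if_forbidden_factors:
  fixes L :: "nat list set"
  assumes irr: "irreducible_language L" and L: "L \<subseteq> lists S"
    and B: "finite B" "\<And>w. w \<in> lists S \<Longrightarrow> w \<in> L \<longleftrightarrow> \<not> (\<exists>b\<in>B. \<exists>p q. w = p @ b @ q)"
  shows "\<exists>d. finite_type_language L d"
proof (intro exI finite_type_language.intro irr finite_type_language_axioms.intro)
  fix s u v :: "nat list"
  \<comment> \<open>The sum of the lengths is a convenient bound for the longest forbidden
    word.\<close>
  assume len: "(\<Sum>b\<in>B. length b) \<le> length s" and us: "u @ s \<in> L" and sv: "s @ v \<in> L"
  have lists: "u @ s \<in> lists S" "s @ v \<in> lists S" using us sv L by auto
  then have "u @ s @ v \<in> lists S" by simp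
  moreover have False if b: "b \<in> B" and eq: "u @ s @ v = p @ b @ q" for b p q
  proof -
    have "length b \<le> length s" using member_le_sum[OF b, of length] B(1) len by simp
    have us_free: "u @ s \<noteq> p @ b @ r" for r using us B(2)[OF lists(1)] b by blast
    have sv_free: "s @ v \<noteq> p' @ b @ r" for p' r using sv B(2)[OF lists(2)] b by blast
    have "(u @ s) @ v = (p @ b) @ q" using eq by simp
    then obtain r where "u @ s = (p @ b) @ r \<or> (u @ s) @ r = p @ b \<and> v = r @ q"
      using append_eq_append_conv2[of "u @ s" v "p @ b" q] by metis
    then have "(u @ s) @ r = p @ b \<and> v = r @ q"
    proof
      assume "u @ s = (p @ b) @ r"
      then show ?thesis using us_free[of r] by simp
    qed
    then have r: "u @ (s @ r) = p @ b" "v = r @ q" by simp_all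
    from r(1) obtain t where "u = p @ t \<and> t @ s @ r = b \<or> u @ t = p \<and> s @ r = t @ b"
      using append_eq_append_conv2[of u "s @ r" p b] by metis
    then show False
    proof
      assume "u = p @ t \<and> t @ s @ r = b"
      \<comment> \<open>As \<open>b\<close> contains \<open>s\<close> but is no longer,
        \<open>t\<close> is empty, and \<open>b\<close> starts where \<open>s\<close> does.\<close>
      then have "b = s @ r" using \<open>length b \<le> length s\<close> by auto
      then show False using sv_free[of "[]" q] r(2) by simp
    next
      assume "u @ t = p \<and> s @ r = t @ b"
      then have "s @ v = t @ b @ q" using r(2) by (metis append.assoc)
      then show False using sv_free by blast
    qed
  qed
  ultimately show "u @ s @ v \<in> L" using B(2) by blast
qed

section \<open>The language of a prime ideal containing the ideal generated by z\<close>

locale prime_ideal_above_z =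
  fixes n :: nat and H :: "(nat \<Rightarrow> nat) set" and Q :: "nat list set set"
  assumes H: "\<forall>\<sigma>\<in>H. \<sigma> permutes {1..n}"
    and Q_prime: "mon_prime_ideal (Smon n H) (Smult n H) Q"
    and Q_z: "\<forall>s\<in>Smon n H. \<forall>t\<in>Smon n H. Smult n H (Smult n H s (Sz n H)) t \<in> Q"
begin

abbreviation cls :: "nat list \<Rightarrow> nat list set" where "cls \<equiv> Scls n H"

definition L :: "nat list set" where "L = {w \<in> lists {1..n}. cls w \<notin> Q}"

lemma Q_subset: "Q \<subseteq> Smon n H"
  and Q_ideal: "X \<in> Smon n H \<Longrightarrow> Y \<in> Q \<Longrightarrow> Smult n H X Y \<in> Q \<and> Smult n H Y X \<in> Q"
  using Q_prime by (auto simp: mon_prime_ideal_def mon_ideal_def)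

lemma cls_factor:
  assumes "cls w \<in> Q" "x \<in> lists {1..n}" "y \<in> lists {1..n}"
  shows "cls (x @ w @ y) \<in> Q"
  using Q_ideal[OF Scls_Smon[OF assms(2)] conjunct2[OF Q_ideal[OF Scls_Smon[OF assms(3)] assms(1)]]]
  by (simp add: Smult_Scls)

lemma zword_lists: "zword n \<in> lists {1..n}"
  by (auto simp: zword_def)

lemma map_zword_lists:
  assumes "\<sigma> \<in> H" shows "map \<sigma> (zword n) \<in> lists {1..n}"
proof -
  have "\<sigma> ` {1..n} = {1..n}" using H assms by (simp add: permutes_image)
  moreover have "set (zword n) \<subseteq> {1..n}" using zword_lists by (simp only: lists_eq_set mem_Collect_eq)
  ultimately have "set (map \<sigma> (zword n)) \<subseteq> {1..n}" by (metis image_mono set_map)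
  then show ?thesis by (simp only: lists_eq_set mem_Collect_eq)
qed

lemma cls_z:
  assumes "x \<in> lists {1..n}" "y \<in> lists {1..n}"
  shows "cls (x @ zword n @ y) \<in> Q"
proof -
  have "Smult n H (Smult n H (cls x) (Sz n H)) (cls y) \<in> Q"
    using Q_z Scls_Smon assms by blast
  then show ?thesis by (simp add: Sz_def Smult_Scls)
qed

lemma step_in_Q:
  assumes "symclp (Sstep n H) v w" "v \<in> lists {1..n}"
  shows "\<exists>x y b. v = x @ b @ y \<and> b \<in> insert (zword n) ((\<lambda>\<sigma>. map \<sigma> (zword n)) ` H)"
  using assms(1) by (auto elim!: symclpE simp: Sstep_def) blast+

text \<open>The permuted words are congruent to \<open>zword n\<close>, so one class in
  \<open>Q\<close> covers both sides of every relation.\<close>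

lemma relator_in_Q:
  assumes b: "b \<in> insert (zword n) ((\<lambda>\<sigma>. map \<sigma> (zword n)) ` H)"
    and xy: "x \<in> lists {1..n}" "y \<in> lists {1..n}"
  shows "cls (x @ b @ y) \<in> Q"
proof (cases "b = zword n")
  case True
  then show ?thesis using cls_z xy by simp
next
  case False
  then obtain \<sigma> where "\<sigma> \<in> H" "b = map \<sigma> (zword n)" using b by blast
  then have "Sstep n H (x @ zword n @ y) (x @ b @ y)" unfolding Sstep_def by blast
  then have "Scong n H (x @ zword n @ y) (x @ b @ y)"
    unfolding Scong_def by (intro r_into_rtranclp symclpI1)
  then show ?thesis using cls_z[OF xy] Scls_eq_iff by metis
qed

lemma L_lists: "w \<in> L \<Longrightarrow> w \<in> lists {1..n}"
  by (simp add: L_def)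

text \<open>No relation applies to a word outside the ideal.\<close>

lemma cls_L:
  assumes w: "w \<in> L" shows "cls w = {w}"
proof -
  have "v = w" if "Scong n H w v" for v
  proof (rule ccontr)
    assume "v \<noteq> w"
    with that obtain y where "symclp (Sstep n H) w y"
      unfolding Scong_def by (auto elim: converse_rtranclpE)
    from step_in_Q[OF this L_lists[OF w]] obtain x b y where b: "w = x @ b @ y"
      "b \<in> insert (zword n) ((\<lambda>\<sigma>. map \<sigma> (zword n)) ` H)" by (elim exE conjE)
    then have "x \<in> lists {1..n}" "y \<in> lists {1..n}" using L_lists[OF w] by simp_all
    then have "cls w \<in> Q" using relator_in_Q b by simp
    then show False using w by (simp add: L_def)
  qed
  then show ?thesis by (auto simp: Scls_def Scong_refl)
qed

text \<open>If nothing connected \<open>u\<close> to \<open>v\<close>, all products of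
  \<open>cls u\<close>, an arbitrary class and \<open>cls v\<close> would lie in \<open>Q\<close>,
  and primeness would put \<open>cls u\<close> or \<open>cls v\<close> into
  \<open>Q\<close>.\<close>

lemma irreducible_L: "irreducible_language L"
proof
  have "cls [] \<notin> Q"
  proof
    assume "cls [] \<in> Q"
    then have "cls w \<in> Q" if "w \<in> lists {1..n}" for w
      using cls_factor[of "[]" w "[]"] that by simp
    then have "Q = Smon n H" using Q_subset by (auto simp: Smon_def)
    then show False using Q_prime by (simp add: mon_prime_ideal_def)
  qed
  then show "[] \<in> L" by (simp add: L_def)
  fix u v
  show "u @ v \<in> L \<Longrightarrow> u \<in> L" using cls_factor[of u "[]" v] by (auto simp: L_def)
  show "u @ v \<in> L \<Longrightarrow> v \<in> L" using cls_factor[of v u "[]"] by (auto simp: L_def)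
  assume uv: "u \<in> L" "v \<in> L"
  show "\<exists>s. u @ s @ v \<in> L"
  proof (rule ccontr)
    assume none: "\<not> ?thesis"
    have "{Smult n H (Smult n H (cls u) s) (cls v) | s. s \<in> Smon n H} \<subseteq> Q"
    proof clarify
      fix X assume "X \<in> Smon n H"
      then obtain s where s: "s \<in> lists {1..n}" "X = cls s" by (rule SmonE)
      have "u @ s @ v \<in> lists {1..n}" using s uv by (auto simp: L_def)
      then have "cls (u @ s @ v) \<in> Q" using none by (auto simp: L_def)
      then show "Smult n H (Smult n H (cls u) X) (cls v) \<in> Q" by (simp add: s Smult_Scls)
    qed
    moreover have "cls u \<in> Smon n H" "cls v \<in> Smon n H" using uv Scls_Smon L_lists by blast+
    ultimately have "cls u \<in> Q \<or> cls v \<in> Q"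
      using Q_prime unfolding mon_prime_ideal_def by blast
    then show False using uv by (simp add: L_def)
  qed
qed

text \<open>The forbidden words are both sides of all relations together with one representative of
  each generator of \<open>Q\<close>.\<close>

lemma finite_type_L:
  assumes "mon_ideal_fin_gen (Smon n H) (Smult n H) Q"
  shows "\<exists>d. finite_type_language L d"
proof -
  obtain F where F: "finite F" "F \<subseteq> Q"
    "Q = {Smult n H (Smult n H s f) t | s f t. s \<in> Smon n H \<and> f \<in> F \<and> t \<in> Smon n H}"
    using assms unfolding mon_ideal_fin_gen_def by blast
  have "\<forall>f\<in>F. \<exists>r. r \<in> lists {1..n} \<and> f = cls r" using F(2) Q_subset by (blast elim: SmonE)
  then obtain r where r: "\<And>f. f \<in> F \<Longrightarrow> r f \<in> lists {1..n} \<and> f = cls (r f)" by metis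
  let ?Z = "insert (zword n) ((\<lambda>\<sigma>. map \<sigma> (zword n)) ` H)"
  \<comment> \<open>All relators have length \<open>n\<close> over a finite alphabet, so there are
    finitely many.\<close>
  have "length (zword n) = n" by (simp add: zword_def)
  then have "?Z \<subseteq> {w. set w \<subseteq> {1..n} \<and> length w = n}"
    using zword_lists map_zword_lists unfolding lists_eq_set by (auto simp del: set_map)
  then have "finite ?Z" by (rule finite_subset) (intro finite_lists_length_eq finite_atLeastAtMost)
  then have fin: "finite (?Z \<union> r ` F)" using F(1) by simp
  show ?thesis
  proof (rule finite_type_if_forbidden_factors[OF irreducible_L _ fin])
    show "L \<subseteq> lists {1..n}" using L_lists by blast
    fix w :: "nat list" assume w: "w \<in> lists {1..n}"
    show "w \<in> L \<longleftrightarrow> \<not> (\<exists>b\<in>?Z \<union> r ` F. \<exists>p q. w = p @ b @ q)"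
    proof
      assume wL: "w \<in> L"
      show "\<not> (\<exists>b\<in>?Z \<union> r ` F. \<exists>p q. w = p @ b @ q)"
      proof
        assume "\<exists>b\<in>?Z \<union> r ` F. \<exists>p q. w = p @ b @ q"
        then obtain b p q where b: "b \<in> ?Z \<union> r ` F" "w = p @ b @ q" by blast
        have pq: "p \<in> lists {1..n}" "q \<in> lists {1..n}" using w b(2) by auto
        have "cls w \<in> Q"
        proof (cases "b \<in> ?Z")
          case True
          then show ?thesis using relator_in_Q[OF _ pq] b(2) by simp
        next
          case False
          then obtain f where "f \<in> F" "b = r f" using b(1) by blast
          then have "cls b \<in> Q" using r F(2) by auto
          then show ?thesis using cls_factor[OF _ pq] b(2) by simp
        qed
        then show False using wL by (simp add: L_def)
      qed
    next
      assume no: "\<not> (\<exists>b\<in>?Z \<union> r ` F. \<exists>p q. w = p @ b @ q)"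
      show "w \<in> L"
      proof (rule ccontr)
        assume "w \<notin> L"
        then have "cls w \<in> Q" using w by (simp add: L_def)
        then obtain s f t where sft: "s \<in> Smon n H" "f \<in> F" "t \<in> Smon n H"
          "cls w = Smult n H (Smult n H s f) t" using F(3) by blast
        obtain s' t' where "s = cls s'" "t = cls t'" using sft(1,3) by (auto elim!: SmonE)
        then have "cls w = cls (s' @ r f @ t')"
          using sft(4) r[OF sft(2)] Smult_Scls[of n H] by (metis append.assoc)
        then have "Scong n H w (s' @ r f @ t')" by (simp add: Scls_eq_iff)
        moreover have "w \<noteq> s' @ r f @ t'" using no sft(2) by blast
        \<comment> \<open>The congruent words differ, so some relation applies to \<open>w\<close>
          itself, which therefore contains a relator.\<close>
        ultimately obtain y where "symclp (Sstep n H) w y"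
          unfolding Scong_def by (auto elim: converse_rtranclpE)
        from step_in_Q[OF this w] obtain x b y' where "w = x @ b @ y'" "b \<in> ?Z" by (elim exE conjE)
        have "b \<in> ?Z \<union> r ` F" using \<open>b \<in> ?Z\<close> by (rule UnI1)
        with \<open>w = x @ b @ y'\<close> show False using no by blast
      qed
    qed
  qed
qed

section \<open>Coordinates of K[S]/K[Q] and conclusion\<close>

definition coeffs :: "(nat list set \<Rightarrow> 'k::field) \<Rightarrow> nat list \<Rightarrow> 'k" where
  "coeffs f = (\<lambda>w. if w \<in> L then f (cls w) else 0)"

context
  fixes KS :: "(nat list set \<Rightarrow> 'k::field) ring"
  defines "KS \<equiv> malg (Smon n H) (Smult n H) (Sone n H)"
begin

lemma KS_carrier: "carrier KS = {f. finite {x. f x \<noteq> 0} \<and> (\<forall>x. f x \<noteq> 0 \<longrightarrow> x \<in> Smon n H)}"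
  by (simp add: KS_def malg_simps)

text \<open>As \<open>cls u\<close> is the singleton of \<open>u\<close>, two classes with product
  \<open>cls u\<close> have representatives that concatenate to \<open>u\<close> itself. The
  factorizations in the monoid are thus the cuts of \<open>u\<close>.\<close>

lemma coeffs_mult:
  assumes u: "u \<in> L"
  shows "(f \<otimes>\<^bsub>KS\<^esub> g) (cls u) = (\<Sum>i\<le>length u. f (cls (take i u)) * g (cls (drop i u)))"
proof -
  interpret irreducible_language L by (rule irreducible_L)
  let ?T = "{(X, Y). X \<in> Smon n H \<and> Y \<in> Smon n H \<and> f X \<noteq> 0 \<and> g Y \<noteq> 0 \<and> Smult n H X Y = cls u}"
  let ?s = "\<lambda>i. (cls (take i u), cls (drop i u))"
  have parts: "take i u \<in> L" "drop i u \<in> L" for i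
    using u prefix_mem[of "take i u" "drop i u"] suffix_mem[of "take i u" "drop i u"] by simp_all
  have "inj_on ?s {..length u}"
  proof (rule inj_onI)
    fix i j assume ij: "i \<in> {..length u}" "j \<in> {..length u}" "?s i = ?s j"
    then have "take i u = take j u" using cls_L parts by simp
    then have "length (take i u) = length (take j u)" by (rule arg_cong)
    then show "i = j" using ij by simp
  qed
  then have "(\<Sum>i\<le>length u. f (cls (take i u)) * g (cls (drop i u))) = (\<Sum>p\<in>?s ` {..length u}. f (fst p) * g (snd p))"
    by (simp add: sum.reindex)
  also have "\<dots> = (\<Sum>p\<in>?T. f (fst p) * g (snd p))"
  proof (rule sum.mono_neutral_right)
    show "?T \<subseteq> ?s ` {..length u}"
    proof
      fix p assume "p \<in> ?T"
      then obtain X Y where p: "p = (X, Y)" "X \<in> Smon n H" "Y \<in> Smon n H" "Smult n H X Y = cls u" by blast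
      obtain x y where xy: "X = cls x" "Y = cls y" using p(2,3) by (auto elim!: SmonE)
      then have "x @ y \<in> cls u" using p(4) mem_Scls[of "x @ y" n H] by (simp add: Smult_Scls)
      then have "x @ y = u" using cls_L[OF u] by simp
      then show "p \<in> ?s ` {..length u}" using p(1) xy by (intro image_eqI[of _ _ "length x"]) auto
    qed
    show "\<forall>p\<in>?s ` {..length u} - ?T. f (fst p) * g (snd p) = 0"
      using Scls_Smon L_lists parts by (auto simp: Smult_Scls)
  qed simp
  also have "\<dots> = (f \<otimes>\<^bsub>KS\<^esub> g) (cls u)" by (simp add: KS_def malg_def)
  finally show ?thesis ..
qed

lemma coeffs_hom: "coeffs \<in> ring_hom KS (lang_alg L)"
proof (rule ring_hom_memI)
  interpret irreducible_language L by (rule irreducible_L)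
  fix f g assume f: "f \<in> carrier KS" and g: "g \<in> carrier KS"
  have "{w. coeffs f w \<noteq> 0} \<subseteq> the_elem ` {X. f X \<noteq> 0}"
  proof
    fix w assume "w \<in> {w. coeffs f w \<noteq> 0}"
    then have "w \<in> L" "f (cls w) \<noteq> 0" by (auto simp: coeffs_def split: if_splits)
    then show "w \<in> the_elem ` {X. f X \<noteq> 0}" using cls_L by (intro image_eqI[of _ _ "cls w"]) auto
  qed
  moreover have "finite {X. f X \<noteq> 0}" using f by (simp add: KS_carrier)
  ultimately have "finite {w. coeffs f w \<noteq> 0}" by (meson finite_imageI finite_subset)
  then show "coeffs f \<in> carrier (lang_alg L)" by (simp add: lang_alg_simps coeffs_def)
  show "coeffs (f \<oplus>\<^bsub>KS\<^esub> g) = coeffs f \<oplus>\<^bsub>lang_alg L\<^esub> coeffs g"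
    by (auto simp: coeffs_def KS_def malg_simps lang_alg_simps)
  have "take i u \<in> L \<and> drop i u \<in> L" if "u \<in> L" for i u
    using that prefix_mem[of "take i u" "drop i u"] suffix_mem[of "take i u" "drop i u"] by simp
  then show "coeffs (f \<otimes>\<^bsub>KS\<^esub> g) = coeffs f \<otimes>\<^bsub>lang_alg L\<^esub> coeffs g"
    unfolding lang_alg_simps coeffs_def by (intro ext) (simp add: coeffs_mult)
next
  have "cls w = Sone n H \<longleftrightarrow> w = []" if "w \<in> L" for w
  proof
    assume *: "cls w = Sone n H"
    have "[] \<in> cls w" unfolding * Sone_def by (rule mem_Scls)
    then show "w = []" using cls_L[OF that] by simp
  qed (simp add: Sone_def)
  moreover have "[] \<in> L" using irreducible_L by (rule irreducible_language.Nil_mem)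
  ultimately show "coeffs \<one>\<^bsub>KS\<^esub> = \<one>\<^bsub>lang_alg L\<^esub>"
    by (auto simp: coeffs_def KS_def malg_simps lang_alg_simps)
qed

lemma coeffs_surj: "coeffs ` carrier KS = carrier (lang_alg L)"
proof
  show "coeffs ` carrier KS \<subseteq> carrier (lang_alg L)" using ring_hom_closed[OF coeffs_hom] by blast
  show "carrier (lang_alg L) \<subseteq> coeffs ` carrier KS"
  proof
    fix h :: "nat list \<Rightarrow> 'k" assume h: "h \<in> carrier (lang_alg L)"
    \<comment> \<open>The lift lives on the singleton classes of \<open>L\<close>, where
      \<open>the_elem\<close> recovers the word, and is zero elsewhere.\<close>
    let ?f = "\<lambda>X. if X \<in> cls ` L then h (the_elem X) else 0"
    have "{X. ?f X \<noteq> 0} \<subseteq> cls ` {w. h w \<noteq> 0}"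
    proof
      fix X assume "X \<in> {X. ?f X \<noteq> 0}"
      then have "X \<in> cls ` L" "h (the_elem X) \<noteq> 0" by (auto split: if_splits)
      then obtain w where "X = cls w" "w \<in> L" "h (the_elem X) \<noteq> 0" by blast
      then show "X \<in> cls ` {w. h w \<noteq> 0}" using cls_L[of w] by (intro image_eqI[of _ _ w]) simp_all
    qed
    moreover have "finite (cls ` {w. h w \<noteq> 0})" using h by (simp add: lang_alg_simps)
    ultimately have "finite {X. ?f X \<noteq> 0}" by (rule finite_subset)
    moreover have "X \<in> Smon n H" if "?f X \<noteq> 0" for X
      using that Scls_Smon L_lists by (auto split: if_splits)
    ultimately have f: "?f \<in> carrier KS" by (simp add: KS_carrier)
    have "coeffs ?f = h"
      using h cls_L by (auto simp: coeffs_def lang_alg_simps fun_eq_iff)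
    then show "h \<in> coeffs ` carrier KS" using imageI[OF f, of coeffs] by (simp only:)
  qed
qed

text \<open>Every class outside \<open>Q\<close> is the class of a word of \<open>L\<close>, so
  vanishing coordinates mean support in \<open>Q\<close>.\<close>

lemma coeffs_kernel:
  "malg_span (Smon n H) (Smult n H) (Sone n H) Q = {f \<in> carrier KS. coeffs f = \<zero>\<^bsub>lang_alg L\<^esub>}"
proof -
  have "(\<forall>X. f X \<noteq> 0 \<longrightarrow> X \<in> Q) \<longleftrightarrow> coeffs f = (\<lambda>w. 0)" if f: "f \<in> carrier KS" for f
  proof
    assume "\<forall>X. f X \<noteq> 0 \<longrightarrow> X \<in> Q"
    then show "coeffs f = (\<lambda>w. 0)" by (auto simp: coeffs_def L_def fun_eq_iff)
  next
    assume 0: "coeffs f = (\<lambda>w. 0)"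
    show "\<forall>X. f X \<noteq> 0 \<longrightarrow> X \<in> Q"
    proof (intro allI impI)
      fix X assume X: "f X \<noteq> 0"
      then have "X \<in> Smon n H" using f by (simp add: KS_carrier)
      then obtain w where w: "w \<in> lists {1..n}" "X = cls w" by (rule SmonE)
      show "X \<in> Q"
      proof (rule ccontr)
        assume "X \<notin> Q"
        then have "w \<in> L" using w by (simp add: L_def)
        then show False using fun_cong[OF 0, of w] X w by (simp add: coeffs_def)
      qed
    qed
  qed
  then show ?thesis unfolding malg_span_def KS_def[symmetric] lang_alg_simps by blast
qed

theorem quotient_properties:
  defines "KQ \<equiv> malg_span (Smon n H) (Smult n H) (Sone n H) Q"
  defines "A \<equiv> KS Quot KQ" and "smA \<equiv> quot_smult KS KQ malg_smult"
  shows "prime_ring A" and "monomial_algebra A smA"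
    and "mon_ideal_fin_gen (Smon n H) (Smult n H) Q \<Longrightarrow> PI_algebra A smA \<or> primitive_ring A"
proof -
  have sub: "L \<subseteq> lists {1..n}" using L_lists by blast
  have ringKS: "ring KS" unfolding KS_def by (rule ring_Smon_alg)
  let ?F = "free_alg n :: (nat list \<Rightarrow> 'k) ring"
  let ?W = "lists {1..n} - L"
  let ?I = "genideal ?F (word_elem ` ?W)"
  note free = free_alg_monomial_quotient[OF irreducible_L sub, where 'k = 'k]
  have sm: "malg_smult c f \<in> carrier KS \<and> coeffs (malg_smult c f) = malg_smult c (coeffs f)"
    if "f \<in> carrier KS" for c f
  proof -
    have "finite {X. c * f X \<noteq> 0}"
      using that by (auto simp: KS_carrier intro: finite_subset[of _ "{X. f X \<noteq> 0}"])
    then show ?thesis using that by (auto simp: KS_carrier malg_smult_def coeffs_def)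
  qed
  note quot = quotient_kalg_iso[OF ringKS free(1) coeffs_hom coeffs_surj coeffs_kernel,
      of malg_smult malg_smult, OF sm, folded KQ_def, folded A_def smA_def]
  let ?c = "\<lambda>X. the_elem (coeffs ` X)"
  have mon: "monomial_alg L A smA ?c"
    by (intro monomial_alg.intro irreducible_L quot(1) monomial_alg_axioms.intro quot(2,3))
  then show "prime_ring A" by (rule monomial_alg.prime)
  \<comment> \<open>Both the quotient of the monoid algebra and the free algebra modulo the words
    outside \<open>L\<close> have coordinates in \<open>lang_alg L\<close>; one isomorphism is
    composed with the inverse of the other.\<close>
  have "kalg_iso A smA (?F Quot ?I) (quot_smult ?F ?I malg_smult)
      (inv_into (carrier (?F Quot ?I)) (\<lambda>X. the_elem (restrict_to L ` X)) \<circ> ?c)"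
    by (rule kalg_iso_trans_sym[OF quot(2) free(3,2,4)])
  then show "monomial_algebra A smA"
    unfolding monomial_algebra_def Let_def by (intro exI[of _ n] exI[of _ ?W] exI conjI) auto
  assume "mon_ideal_fin_gen (Smon n H) (Smult n H) Q"
  then obtain d where d: "finite_type_language L d" using finite_type_L by blast
  show "PI_algebra A smA \<or> primitive_ring A"
  \<comment> \<open>Either \<open>L\<close> has words without small periods for every bound, which
    gives primitivity, or a bound on periods yields one common period and hence the standard
    identity.\<close>
  proof (cases "\<forall>N. \<exists>u\<in>L. \<forall>q. 0 < q \<longrightarrow> q \<le> N \<longrightarrow> \<not> has_period q u")
    case True
    have "finite_type_monomial_alg L A smA ?c d"
      by (intro finite_type_monomial_alg.intro mon d)
    then have "primitive_ring A"
      by (rule finite_type_monomial_alg.primitive) (use True in blast)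
    then show ?thesis ..
  next
    case False
    then obtain N where "\<And>u. u \<in> L \<Longrightarrow> \<exists>q. 0 < q \<and> q \<le> N \<and> has_period q u" by blast
    then obtain D where "0 < D" "\<forall>u\<in>L. has_period D u" using uniform_period[of L N] by blast
    then have "PI_algebra A smA" by (intro monomial_alg.periodic_PI[OF mon]) auto
    then show ?thesis ..
  qed
qed

end

end

theorem theorem4p5:
  fixes n :: nat and H :: "(nat \<Rightarrow> nat) set" and Q :: "nat list set set"
  assumes "\<forall>\<sigma>\<in>H. \<sigma> permutes {1..n}"
    and "mon_prime_ideal (Smon n H) (Smult n H) Q"
    and "\<forall>s\<in>Smon n H. \<forall>t\<in>Smon n H. Smult n H (Smult n H s (Sz n H)) t \<in> Q"
  shows "let KS = (malg (Smon n H) (Smult n H) (Sone n H) :: (nat list set \<Rightarrow> 'k::field) ring);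
             KQ = malg_span (Smon n H) (Smult n H) (Sone n H) Q;
             A = KS Quot KQ;
             smA = quot_smult KS KQ malg_smult
         in prime_ring A \<and> monomial_algebra A smA \<and>
            (mon_ideal_fin_gen (Smon n H) (Smult n H) Q \<longrightarrow>
               PI_algebra A smA \<or> primitive_ring A)"
proof -
  interpret prime_ideal_above_z n H Q by unfold_locales fact+
  show ?thesis unfolding Let_def using quotient_properties by blast
qed

end
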